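(* Let $(X,\varrho)$ be a represented space, let $X^*$ be the Moschovakis extension of $X$ and let $\varrho^*$ be the associated representation of $X^*$. Let $\mathcal{F}_1$ be the set of all partial functions from $X^*$ to $X^*$, and let $\mathcal{B}_1$ be the set of all functions from $\mathcal{F}_1$ which are $(\varrho^*,\varrho^* )$-computable. Then all functions in $\mathcal{F}_1$ that are $\mathfrak{S}_1(X)$-computable in $\mathcal{B}_1$ belong to $\mathcal{B}_1$.
   Context: A representation of a set is a partial mapping of $\mathbb{N}^{\mathbb{N}}$ onto that set; a represented space is a pair (set, representation of that set). Moschovakis extension: fix an object $\boldsymbol{o}\notin X$ and an ordered pair operation such that no element of $X\cup\{\boldsymbol{o}\}$ is an ordered pair; $X^*$ is the closure of $X\cup\{\boldsymbol{o}\}$ under formation of ordered pairs. Representation $\varrho^*$: fix a computable bijection $J:\mathbb{N}^2\to\mathbb{N}$ with $J(m,n)\ge\max(m,n)$ for all $m,n$. The partial mapping $\varrho^*$ of $\mathbb{N}^{\mathbb{N}}$ onto $X^*$ is defined inductively (with $k$ ranging over $\mathbb{N}$): (i) for $q\in\mathrm{dom}(\varrho)$, the sequence $k\mapsto 2q(k)+2$ is in $\mathrm{dom}(\varrho^* )$ and is mapped to $\varrho(q)$; (ii) the constant sequence $k\mapsto 0$ is in $\mathrm{dom}(\varrho^* )$ and is mapped to $\boldsymbol{o}$; (iii) if $q,r\in\mathrm{dom}(\varrho^* )$ then the sequence $k\mapsto 2J(q(k),r(k))+1$ is in $\mathrm{dom}(\varrho^* )$ and is mapped to $(\varrho^*(q),\varrho^*(r))$.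 Computability of functions: a partial mapping $\gamma$ of $\mathbb{N}^{\mathbb{N}}$ into $\mathbb{N}^{\mathbb{N}}$ is computable in the usual (type-2, oracle machine) sense: some oracle machine, given $p\in\mathrm{dom}(\gamma)$ as oracle and $k\in\mathbb{N}$ as input, outputs $\gamma(p)(k)$. For represented spaces $(X_1,\varrho_1)$, $(X_2,\varrho_2)$, a $(\varrho_1,\varrho_2)$-realization of a partial function $\varphi$ from $X_1$ to $X_2$ is any partial mapping $\gamma$ of $\mathbb{N}^{\mathbb{N}}$ into $\mathbb{N}^{\mathbb{N}}$ such that $p\in\mathrm{dom}(\gamma)$, $\gamma(p)\in\mathrm{dom}(\varrho_2)$ and $\varphi(\varrho_1(p))=\varrho_2(\gamma(p))$ for all $p\in\varrho_1^{-1}(\mathrm{dom}(\varphi))$; $\varphi$ is $(\varrho_1,\varrho_2)$-computable if it has a computable $(\varrho_1,\varrho_2)$-realization. The structure $\mathfrak{S}_1(X)$ on $\mathcal{F}_1$: - Multiplication is composition: $\varphi\psi(z)=\varphi(\psi(z))$ with $\mathrm{dom}(\varphi\psi)=\psi^{-1}(\mathrm{dom}(\varphi))$. - $L_1,R_1\in\mathcal{F}_1$ are total: $L_1(\boldsymbol{o})=R_1(\boldsymbol{o})=\boldsymbol{o}$; $L_1(z)=R_1(z)=(\boldsymbol{o},\boldsymbol{o})$ for $z\in X$; $L_1((x,y))=x$, $R_1((x,y))=y$. - $T_1$ and $F_1$ are the constant total functions on $X^*$ with values $(\boldsymbol{o},\boldsymbol{o})$ and $\boldsymbol{o}$, respectively.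 - $\Pi_1(\varphi,\psi)(z)=(\varphi(z),\psi(z))$ with domain $\mathrm{dom}(\varphi)\cap\mathrm{dom}(\psi)$. - Iteration of $\sigma\in\mathcal{F}_1$ controlled by $\chi\in\mathcal{F}_1$ is the function $[\sigma,\chi]\in\mathcal{F}_1$ such that $[\sigma,\chi](z)=v$ iff $z$ and $v$ are the initial and last terms of a finite sequence of elements of $\mathrm{dom}(\chi)$ such that, whenever $u$ is a term of the sequence and $u'$ is its next term, $\chi(u)\notin X\cup\{\boldsymbol{o}\}$, $u\in\mathrm{dom}(\sigma)$ and $u'=\sigma(u)$, and, additionally, $\chi(v)\in X\cup\{\boldsymbol{o}\}$. An element $\theta\in\mathcal{F}_1$ is $\mathfrak{S}_1(X)$-computable in a subset $\mathcal{B}\subseteq\mathcal{F}_1$ if $\theta$ can be obtained from $L_1,R_1,T_1,F_1$ and finitely many elements of $\mathcal{B}$ by means of multiplication, $\Pi_1$ and iteration. *)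

theory Defs
  imports Main
begin

text \<open>
  Oracle machines are unlimited register machines with an oracle instruction (Shepherdson and
  Sturgis; Cutland's URMO). The machine has registers \<open>0, 1, 2, \<dots>\<close> holding natural numbers,
  and \<open>Oracle n\<close> replaces the content \<open>a\<close> of register \<open>n\<close> by \<open>p a\<close>, where \<open>p\<close> is the oracle.
\<close>

datatype instr =
    Zero nat
  | Succ nat
  | Transfer nat nat   \<comment> \<open>source, target\<close>
  | Jump nat nat nat   \<comment> \<open>\<open>Jump m n a\<close>: go to address \<open>a\<close> if registers \<open>m\<close> and \<open>n\<close> agree\<close>
  | Oracle nat

type_synonym config = "nat \<times> (nat \<Rightarrow> nat)"  \<comment> \<open>program counter, register contents\<close>

fun exec_instr :: "(nat \<Rightarrow> nat) \<Rightarrow> instr \<Rightarrow> config \<Rightarrow> config" where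
  "exec_instr p (Zero n) (c, s) = (Suc c, s(n := 0))"
| "exec_instr p (Succ n) (c, s) = (Suc c, s(n := Suc (s n)))"
| "exec_instr p (Transfer m n) (c, s) = (Suc c, s(n := s m))"
| "exec_instr p (Jump m n a) (c, s) = (if s m = s n then a else Suc c, s)"
| "exec_instr p (Oracle n) (c, s) = (Suc c, s(n := p (s n)))"

definition halted :: "instr list \<Rightarrow> config \<Rightarrow> bool" where
  "halted P cf \<longleftrightarrow> length P \<le> fst cf"

definition step :: "instr list \<Rightarrow> (nat \<Rightarrow> nat) \<Rightarrow> config \<Rightarrow> config" where
  "step P p cf = (if halted P cf then cf else exec_instr p (P ! fst cf) cf)"

definition init_config :: "nat list \<Rightarrow> config" where
  "init_config xs = (0, \<lambda>i. if i < length xs then xs ! i else 0)"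

text \<open>The output of a halting computation is the final content of register \<open>0\<close>.\<close>

definition outputs :: "instr list \<Rightarrow> (nat \<Rightarrow> nat) \<Rightarrow> nat list \<Rightarrow> nat \<Rightarrow> bool" where
  "outputs P p xs y \<longleftrightarrow>
     (\<exists>n. halted P ((step P p ^^ n) (init_config xs)) \<and>
          snd ((step P p ^^ n) (init_config xs)) 0 = y)"

text \<open>Nothing is required of the machine on oracles outside the domain of \<open>\<gamma>\<close>.\<close>

definition type2_computable :: "((nat \<Rightarrow> nat) \<rightharpoonup> (nat \<Rightarrow> nat)) \<Rightarrow> bool" where
  "type2_computable \<gamma> \<longleftrightarrow> (\<exists>P. \<forall>p\<in>dom \<gamma>. \<forall>k. outputs P p [k] (the (\<gamma> p) k))"

definition computable2 :: "(nat \<times> nat \<Rightarrow> nat) \<Rightarrow> bool" where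
  "computable2 f \<longleftrightarrow>
     (\<exists>P. (\<forall>n. Oracle n \<notin> set P) \<and> (\<forall>m n. outputs P (\<lambda>_. 0) [m, n] (f (m, n))))"

text \<open>
  A represented space is a pair of a set \<open>X\<close> and a partial map \<open>\<rho>\<close> with \<open>representation \<rho> X\<close>.
\<close>

definition representation :: "((nat \<Rightarrow> nat) \<rightharpoonup> 'a) \<Rightarrow> 'a set \<Rightarrow> bool" where
  "representation \<rho> X \<longleftrightarrow> ran \<rho> = X"

definition realization ::
  "((nat \<Rightarrow> nat) \<rightharpoonup> 'a) \<Rightarrow> ((nat \<Rightarrow> nat) \<rightharpoonup> 'b) \<Rightarrow> ('a \<rightharpoonup> 'b) \<Rightarrow>
   ((nat \<Rightarrow> nat) \<rightharpoonup> (nat \<Rightarrow> nat)) \<Rightarrow> bool" where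
  "realization \<rho>1 \<rho>2 \<phi> \<gamma> \<longleftrightarrow>
     (\<forall>p. p \<in> dom \<rho>1 \<and> the (\<rho>1 p) \<in> dom \<phi> \<longrightarrow>
        p \<in> dom \<gamma> \<and> the (\<gamma> p) \<in> dom \<rho>2 \<and> the (\<phi> (the (\<rho>1 p))) = the (\<rho>2 (the (\<gamma> p))))"

definition rep_computable ::
  "((nat \<Rightarrow> nat) \<rightharpoonup> 'a) \<Rightarrow> ((nat \<Rightarrow> nat) \<rightharpoonup> 'b) \<Rightarrow> ('a \<rightharpoonup> 'b) \<Rightarrow> bool" where
  "rep_computable \<rho>1 \<rho>2 \<phi> \<longleftrightarrow> (\<exists>\<gamma>. type2_computable \<gamma> \<and> realization \<rho>1 \<rho>2 \<phi> \<gamma>)"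

text \<open>
  The Moschovakis extension is formed inside an ambient type \<open>'a\<close> that carries the set \<open>X\<close>, the
  extra object \<open>ob\<close> and the ordered pair operation \<open>pair\<close>.
\<close>

definition moschovakis_data :: "'a set \<Rightarrow> 'a \<Rightarrow> ('a \<times> 'a \<Rightarrow> 'a) \<Rightarrow> bool" where
  "moschovakis_data X ob pair \<longleftrightarrow>
     ob \<notin> X \<and> inj pair \<and> (\<forall>z \<in> X \<union> {ob}. z \<notin> range pair)"

inductive_set mosch_ext :: "'a set \<Rightarrow> 'a \<Rightarrow> ('a \<times> 'a \<Rightarrow> 'a) \<Rightarrow> 'a set"
  for X :: "'a set" and ob :: 'a and pair :: "'a \<times> 'a \<Rightarrow> 'a" where
  atom: "z \<in> X \<union> {ob} \<Longrightarrow> z \<in> mosch_ext X ob pair"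
| pair: "x \<in> mosch_ext X ob pair \<Longrightarrow> y \<in> mosch_ext X ob pair \<Longrightarrow>
         pair (x, y) \<in> mosch_ext X ob pair"

text \<open>The partial map whose graph is \<open>R\<close>; only meant for single-valued \<open>R\<close>.\<close>

definition pfun_of_graph :: "('a \<Rightarrow> 'b \<Rightarrow> bool) \<Rightarrow> 'a \<rightharpoonup> 'b" where
  "pfun_of_graph R x = (if \<exists>y. R x y then Some (THE y. R x y) else None)"

lemma pfun_of_graph_eq_Some_iff:
  assumes "\<And>x y y'. R x y \<Longrightarrow> R x y' \<Longrightarrow> y = y'"
  shows "pfun_of_graph R x = Some y \<longleftrightarrow> R x y"
  using assms unfolding pfun_of_graph_def by (auto intro: theI the_equality)

inductive star_graph ::
  "'a \<Rightarrow> ('a \<times> 'a \<Rightarrow> 'a) \<Rightarrow> (nat \<times> nat \<Rightarrow> nat) \<Rightarrow> ((nat \<Rightarrow> nat) \<rightharpoonup> 'a) \<Rightarrow>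
   (nat \<Rightarrow> nat) \<Rightarrow> 'a \<Rightarrow> bool"
  for ob :: 'a and pair :: "'a \<times> 'a \<Rightarrow> 'a" and J :: "nat \<times> nat \<Rightarrow> nat"
    and \<rho> :: "(nat \<Rightarrow> nat) \<rightharpoonup> 'a" where
  base: "\<rho> q = Some x \<Longrightarrow> star_graph ob pair J \<rho> (\<lambda>k. 2 * q k + 2) x"
| obj: "star_graph ob pair J \<rho> (\<lambda>k. 0) ob"
| pair: "star_graph ob pair J \<rho> q x \<Longrightarrow> star_graph ob pair J \<rho> r y \<Longrightarrow>
         star_graph ob pair J \<rho> (\<lambda>k. 2 * J (q k, r k) + 1) (pair (x, y))"

definition rep_star ::
  "'a \<Rightarrow> ('a \<times> 'a \<Rightarrow> 'a) \<Rightarrow> (nat \<times> nat \<Rightarrow> nat) \<Rightarrow> ((nat \<Rightarrow> nat) \<rightharpoonup> 'a) \<Rightarrow>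
   (nat \<Rightarrow> nat) \<rightharpoonup> 'a" where
  "rep_star ob pair J \<rho> = pfun_of_graph (star_graph ob pair J \<rho>)"

lemma star_graph_functional:
  assumes "inj J" "star_graph ob pair J \<rho> p z" "star_graph ob pair J \<rho> p z'"
  shows "z = z'"
  using assms(2,3)
proof (induction arbitrary: z')
  case (base q x)
  from base.prems show ?case
  proof cases
    case (base q' )
    then have "q = q'" by (auto simp: fun_eq_iff)
    with base \<open>\<rho> q = Some x\<close> show ?thesis by simp
  qed (auto dest!: fun_cong[where x = 0], presburger)
next
  case obj
  then show ?case by cases (auto dest!: fun_cong[where x = 0])
next
  case (pair q x r y)
  from pair.prems show ?case
  proof cases
    case (pair q' x' r' y')
    then have "\<And>k. J (q k, r k) = J (q' k, r' k)" by (auto simp: fun_eq_iff)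
    then have "q = q'" "r = r'" using \<open>inj J\<close> by (auto simp: fun_eq_iff dest: injD)
    with pair pair.IH show ?thesis by metis
  qed (auto dest!: fun_cong[where x = 0], presburger)
qed

lemma rep_star_eq_Some_iff:
  "inj J \<Longrightarrow> rep_star ob pair J \<rho> p = Some z \<longleftrightarrow> star_graph ob pair J \<rho> p z"
  unfolding rep_star_def by (intro pfun_of_graph_eq_Some_iff) (rule star_graph_functional)

lemma representation_rep_star:
  assumes "inj J" "representation \<rho> X"
  shows "representation (rep_star ob pair J \<rho>) (mosch_ext X ob pair)"
proof -
  have "z \<in> mosch_ext X ob pair" if "star_graph ob pair J \<rho> p z" for p z
    using that assms(2)
    by induction (auto simp: representation_def ran_def intro: mosch_ext.intros)
  moreover have "\<exists>p. star_graph ob pair J \<rho> p z" if "z \<in> mosch_ext X ob pair" for z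
    using that assms(2)
    by induction (auto simp: representation_def ran_def intro: star_graph.intros)
  ultimately show ?thesis
    by (auto simp: representation_def ran_def rep_star_eq_Some_iff[OF assms(1)])
qed

text \<open>
  \<open>pfuns A\<close> is the set of all partial functions from \<open>A\<close> to \<open>A\<close>; taken at the Moschovakis
  extension it is \<open>\<F>\<^sub>1\<close>.
\<close>

definition pfuns :: "'a set \<Rightarrow> ('a \<rightharpoonup> 'a) set" where
  "pfuns A = {\<phi>. dom \<phi> \<subseteq> A \<and> ran \<phi> \<subseteq> A}"

definition L1 :: "'a set \<Rightarrow> 'a \<Rightarrow> ('a \<times> 'a \<Rightarrow> 'a) \<Rightarrow> 'a \<rightharpoonup> 'a" where
  "L1 X ob pair = (\<lambda>z. Some (if z = ob then ob else if z \<in> X then pair (ob, ob)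
                              else THE x. \<exists>y. z = pair (x, y))) |` mosch_ext X ob pair"

definition R1 :: "'a set \<Rightarrow> 'a \<Rightarrow> ('a \<times> 'a \<Rightarrow> 'a) \<Rightarrow> 'a \<rightharpoonup> 'a" where
  "R1 X ob pair = (\<lambda>z. Some (if z = ob then ob else if z \<in> X then pair (ob, ob)
                              else THE y. \<exists>x. z = pair (x, y))) |` mosch_ext X ob pair"

definition T1 :: "'a set \<Rightarrow> 'a \<Rightarrow> ('a \<times> 'a \<Rightarrow> 'a) \<Rightarrow> 'a \<rightharpoonup> 'a" where
  "T1 X ob pair = (\<lambda>z. Some (pair (ob, ob))) |` mosch_ext X ob pair"

definition F1 :: "'a set \<Rightarrow> 'a \<Rightarrow> ('a \<times> 'a \<Rightarrow> 'a) \<Rightarrow> 'a \<rightharpoonup> 'a" where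
  "F1 X ob pair = (\<lambda>z. Some ob) |` mosch_ext X ob pair"

definition Pi1 :: "('a \<times> 'a \<Rightarrow> 'a) \<Rightarrow> ('a \<rightharpoonup> 'a) \<Rightarrow> ('a \<rightharpoonup> 'a) \<Rightarrow> 'a \<rightharpoonup> 'a" where
  "Pi1 pair \<phi> \<psi> = (\<lambda>z. Some (pair (the (\<phi> z), the (\<psi> z)))) |` (dom \<phi> \<inter> dom \<psi>)"

definition iter_graph :: "'a set \<Rightarrow> 'a \<Rightarrow> ('a \<rightharpoonup> 'a) \<Rightarrow> ('a \<rightharpoonup> 'a) \<Rightarrow> 'a \<Rightarrow> 'a \<Rightarrow> bool" where
  "iter_graph X ob \<sigma> \<chi> z v \<longleftrightarrow>
     (\<exists>us. us \<noteq> [] \<and> hd us = z \<and> last us = v \<and> set us \<subseteq> dom \<chi> \<and>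
        (\<forall>i. Suc i < length us \<longrightarrow>
           the (\<chi> (us ! i)) \<notin> X \<union> {ob} \<and> us ! i \<in> dom \<sigma> \<and> us ! Suc i = the (\<sigma> (us ! i))) \<and>
        the (\<chi> v) \<in> X \<union> {ob})"

definition iteration :: "'a set \<Rightarrow> 'a \<Rightarrow> ('a \<rightharpoonup> 'a) \<Rightarrow> ('a \<rightharpoonup> 'a) \<Rightarrow> 'a \<rightharpoonup> 'a" where
  "iteration X ob \<sigma> \<chi> = pfun_of_graph (iter_graph X ob \<sigma> \<chi>)"

lemma iter_graph_functional:
  assumes "iter_graph X ob \<sigma> \<chi> z v" "iter_graph X ob \<sigma> \<chi> z v'"
  shows "v = v'"
proof -
  have shorter: "length vs \<le> length us"
    if us: "us \<noteq> []" "the (\<chi> (last us)) \<in> X \<union> {ob}" "hd us = hd vs"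
      and vs: "vs \<noteq> []"
      and stu: "\<forall>i. Suc i < length us \<longrightarrow> us ! Suc i = the (\<sigma> (us ! i))"
      and stv: "\<forall>i. Suc i < length vs \<longrightarrow>
            the (\<chi> (vs ! i)) \<notin> X \<union> {ob} \<and> vs ! Suc i = the (\<sigma> (vs ! i))"
    for us vs
  proof (rule ccontr)
    assume "\<not> length vs \<le> length us"
    then have len: "length us < length vs" by simp
    have eq: "us ! i = vs ! i" if "i < length us" for i
      using that
    proof (induction i)
      case 0
      then show ?case using us vs by (simp add: hd_conv_nth)
    next
      case (Suc i)
      then show ?case using stu stv len by simp
    qed
    have "last us = vs ! (length us - 1)" using us(1) eq by (simp add: last_conv_nth)
    moreover have "Suc (length us - 1) < length vs" using us(1) len by simp
    ultimately show False using stv us(2) by metis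
  qed
  obtain us where us: "us \<noteq> []" "hd us = z" "last us = v"
    "\<forall>i. Suc i < length us \<longrightarrow>
       the (\<chi> (us ! i)) \<notin> X \<union> {ob} \<and> us ! Suc i = the (\<sigma> (us ! i))"
    "the (\<chi> v) \<in> X \<union> {ob}"
    using assms(1) unfolding iter_graph_def by blast
  obtain vs where vs: "vs \<noteq> []" "hd vs = z" "last vs = v'"
    "\<forall>i. Suc i < length vs \<longrightarrow>
       the (\<chi> (vs ! i)) \<notin> X \<union> {ob} \<and> vs ! Suc i = the (\<sigma> (vs ! i))"
    "the (\<chi> v') \<in> X \<union> {ob}"
    using assms(2) unfolding iter_graph_def by blast
  have len: "length us = length vs"
    using shorter[of us vs] shorter[of vs us] us vs by (simp add: order_antisym)
  have "us ! i = vs ! i" if "i < length us" for i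
    using that
  proof (induction i)
    case 0
    then show ?case using us vs by (metis hd_conv_nth)
  next
    case (Suc i)
    then show ?case using us(4) vs(4) len by simp
  qed
  then have "us = vs" using len by (simp add: nth_equalityI)
  then show ?thesis using us vs by simp
qed

lemma iteration_eq_Some_iff:
  "iteration X ob \<sigma> \<chi> z = Some v \<longleftrightarrow> iter_graph X ob \<sigma> \<chi> z v"
  unfolding iteration_def by (intro pfun_of_graph_eq_Some_iff) (rule iter_graph_functional)

text \<open>
  The functions \<open>\<SS>\<^sub>1(X)\<close>-computable in \<open>B\<close>. Multiplication is composition of partial
  maps, \<open>map_comp\<close>. A derivation uses only finitely many elements of \<open>B\<close>.
\<close>

inductive_set S1_computable ::
  "'a set \<Rightarrow> 'a \<Rightarrow> ('a \<times> 'a \<Rightarrow> 'a) \<Rightarrow> ('a \<rightharpoonup> 'a) set \<Rightarrow> ('a \<rightharpoonup> 'a) set"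
  for X :: "'a set" and ob :: 'a and pair :: "'a \<times> 'a \<Rightarrow> 'a" and B :: "('a \<rightharpoonup> 'a) set" where
  L: "L1 X ob pair \<in> S1_computable X ob pair B"
| R: "R1 X ob pair \<in> S1_computable X ob pair B"
| T: "T1 X ob pair \<in> S1_computable X ob pair B"
| F: "F1 X ob pair \<in> S1_computable X ob pair B"
| given: "\<theta> \<in> B \<Longrightarrow> \<theta> \<in> S1_computable X ob pair B"
| mult: "\<phi> \<in> S1_computable X ob pair B \<Longrightarrow> \<psi> \<in> S1_computable X ob pair B \<Longrightarrow>
         \<phi> \<circ>\<^sub>m \<psi> \<in> S1_computable X ob pair B"
| Pi: "\<phi> \<in> S1_computable X ob pair B \<Longrightarrow> \<psi> \<in> S1_computable X ob pair B \<Longrightarrow>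
       Pi1 pair \<phi> \<psi> \<in> S1_computable X ob pair B"
| iter: "\<sigma> \<in> S1_computable X ob pair B \<Longrightarrow> \<chi> \<in> S1_computable X ob pair B \<Longrightarrow>
         iteration X ob \<sigma> \<chi> \<in> S1_computable X ob pair B"

definition B1 ::
  "'a set \<Rightarrow> 'a \<Rightarrow> ('a \<times> 'a \<Rightarrow> 'a) \<Rightarrow> (nat \<times> nat \<Rightarrow> nat) \<Rightarrow> ((nat \<Rightarrow> nat) \<rightharpoonup> 'a) \<Rightarrow>
   ('a \<rightharpoonup> 'a) set" where
  "B1 X ob pair J \<rho> =
     {\<phi> \<in> pfuns (mosch_ext X ob pair).
        rep_computable (rep_star ob pair J \<rho>) (rep_star ob pair J \<rho>) \<phi>}"

end

theory Submission
  imports Defs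
begin

text \<open>
  Everything reduces to a closure property of oracle machines. Composition and pairing of realized
  functions need a machine to consult an oracle that is itself computed by another machine.
  Iteration needs more: the number of applications of \<open>\<sigma>\<close> is found at run time, so the machine for
  \<open>\<sigma>\<close> has to be stacked on itself to an unbounded depth. If \<open>G\<close> is the operator on sequences computed
  by the machine \<open>P\<close> of \<open>\<sigma>\<close>, then the \<open>k\<close>-th entry of \<open>G\<^sup>n(p)\<close> must be computable from \<open>p\<close> uniformly
  in \<open>n\<close> and \<open>k\<close>.
  
  The lemma \<open>calls_tower\<close> supplies this. A single machine with oracle \<open>p\<close> simulates a program \<open>Q\<close> whose
  oracle is \<open>G\<^sup>e(p)\<close>, where \<open>e\<close> is an input. A query made \<open>u < e\<close> levels down suspends the current run,
  pushes its registers on a stack and starts \<open>P\<close> on the queried number; a query at level \<open>e\<close> goes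
  to \<open>p\<close>. The stack is one number, built with the pairing function \<open>J\<close>. The program of \<open>J\<close> and the
  searches that invert it are obtained from the case \<open>e = 0\<close>, in which nothing is ever pushed, so
  there is no circularity.
  
  Composition is the case \<open>e = 1\<close>. For pairing one computes \<open>2 J(q(k), r(k)) + 1\<close>. For iteration, whether
  \<open>\<chi>\<close> sends a term of the sequence to an atom can be read off the parity of the first entry of
  a name of the value of \<open>\<chi>\<close>: names of atoms have only even entries, names of pairs only odd ones
  (\<open>names_atom_iff\<close>). The length of the sequence is therefore the least \<open>n\<close> at which the machine of \<open>\<chi>\<close>,
  run on the \<open>n\<close>-th iterate, outputs an even number; this is an unbounded search, and the value is
  named by that iterate. The functions \<open>L\<^sub>1\<close> and \<open>R\<^sub>1\<close> act on names entry by entry, again because the parity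
  of an entry does not depend on its position.
  
  The programs are written in a small structured language embedded into the machine
  instructions, with a calling convention that makes procedures composable.
\<close>
section \<open>Structured programming of oracle machines\<close>

type_synonym state = "nat \<Rightarrow> nat"

text \<open>
  A piece of code is given as a function of the address at which it is placed, because the jump
  targets of the machine are absolute.
\<close>
type_synonym code = "nat \<Rightarrow> instr list"

definition reaches :: "instr list \<Rightarrow> state \<Rightarrow> config \<Rightarrow> config \<Rightarrow> bool" where
  "reaches P p cf cf' \<longleftrightarrow> (\<exists>n. (step P p ^^ n) cf = cf')"

lemma reaches_refl: "reaches P p cf cf"
  unfolding reaches_def by (rule exI[of _ 0]) simp

lemma reaches_trans [trans]:
  assumes "reaches P p a b" "reaches P p b c"
  shows "reaches P p a c"
proof -
  obtain m n where "(step P p ^^ m) a = b" "(step P p ^^ n) b = c"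
    using assms unfolding reaches_def by blast
  then have "(step P p ^^ (n + m)) a = c" by (simp add: funpow_add)
  then show ?thesis unfolding reaches_def by blast
qed

lemma reaches_step: "step P p a = b \<Longrightarrow> reaches P p a b"
  unfolding reaches_def by (rule exI[of _ 1]) simp

text \<open>
  Correctness of a piece of code in every surrounding program: control enters at its first address
  with registers \<open>s\<close> and leaves just behind its last address with registers \<open>t\<close>. Quantifying over the
  surroundings is what makes the rules for sequencing and branching compositional.
\<close>
definition exec :: "state \<Rightarrow> code \<Rightarrow> state \<Rightarrow> state \<Rightarrow> bool" where
  "exec p c s t \<longleftrightarrow> (\<forall>pre post. reaches (pre @ c (length pre) @ post) p
     (length pre, s) (length pre + length (c (length pre)), t))"

lemma execD:
  assumes "exec p c s t" "P = pre @ c (length pre) @ post" "a = length pre"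
  shows "reaches P p (a, s) (a + length (c a), t)"
  using assms unfolding exec_def by blast

definition skip :: code where
  "skip a = []"

definition ins :: "instr \<Rightarrow> code" where
  "ins i a = [i]"

definition seqc :: "code \<Rightarrow> code \<Rightarrow> code"  (infixr ";;" 60) where
  "(c ;; d) a = c a @ d (a + length (c a))"

definition ifeq :: "nat \<Rightarrow> nat \<Rightarrow> code \<Rightarrow> code \<Rightarrow> code" where
  "ifeq m n c d a =
     (let D = d (a + 1); C = c (a + length D + 2)
      in Jump m n (a + length D + 2) # D @ Jump 0 0 (a + length D + 2 + length C) # C)"

definition while_neq :: "nat \<Rightarrow> nat \<Rightarrow> code \<Rightarrow> code" where
  "while_neq m n c a =
     (let C = c (a + 1) in Jump m n (a + length C + 2) # C @ [Jump 0 0 a])"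

lemma exec_skip: "exec p skip s s"
  by (simp add: exec_def skip_def reaches_refl)

lemma exec_ins:
  assumes "\<And>c. exec_instr p i (c, s) = (Suc c, t)"
  shows "exec p (ins i) s t"
  unfolding exec_def ins_def
  by (auto intro!: reaches_step simp: step_def halted_def nth_append assms)

lemma exec_seqc:
  assumes "exec p c s s'" "exec p d s' t"
  shows "exec p (c ;; d) s t"
  unfolding exec_def
proof (intro allI)
  fix pre post :: "instr list"
  let ?a = "length pre" and ?C = "c (length pre)"
  let ?P = "pre @ (c ;; d) ?a @ post"
  have "reaches ?P p (?a, s) (?a + length ?C, s')"
    by (rule execD[OF assms(1)]) (auto simp: seqc_def)
  also have "reaches ?P p (?a + length ?C, s')
    (?a + length ?C + length (d (?a + length ?C)), t)"
    by (rule execD[OF assms(2), where pre = "pre @ ?C"]) (auto simp: seqc_def)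
  finally show "reaches ?P p (?a, s) (?a + length ((c ;; d) ?a), t)"
    by (simp add: seqc_def add.assoc)
qed

lemma exec_ifeq_true:
  assumes "s m = s n" "exec p c s t"
  shows "exec p (ifeq m n c d) s t"
  unfolding exec_def
proof (intro allI)
  fix pre post :: "instr list"
  let ?a = "length pre"
  let ?P = "pre @ ifeq m n c d ?a @ post"
  let ?D = "d (?a + 1)"
  let ?x = "?a + length ?D + 2"
  have "reaches ?P p (?a, s) (?x, s)"
    using assms(1)
    by (intro reaches_step) (simp add: step_def halted_def nth_append ifeq_def Let_def)
  also have "reaches ?P p (?x, s) (?x + length (c ?x), t)"
    by (rule execD[OF assms(2), where
          pre = "pre @ Jump m n ?x # ?D @ [Jump 0 0 (?x + length (c ?x))]"])
      (auto simp: ifeq_def Let_def)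
  finally show "reaches ?P p (?a, s) (?a + length (ifeq m n c d ?a), t)"
    by (simp add: ifeq_def Let_def add.assoc)
qed

lemma exec_ifeq_false:
  assumes "s m \<noteq> s n" "exec p d s t"
  shows "exec p (ifeq m n c d) s t"
  unfolding exec_def
proof (intro allI)
  fix pre post :: "instr list"
  let ?a = "length pre"
  let ?P = "pre @ ifeq m n c d ?a @ post"
  let ?D = "d (?a + 1)"
  let ?x = "?a + length ?D + 2"
  have "reaches ?P p (?a, s) (?a + 1, s)"
    using assms(1)
    by (intro reaches_step) (simp add: step_def halted_def nth_append ifeq_def Let_def)
  also have "reaches ?P p (?a + 1, s) (?a + 1 + length ?D, t)"
    by (rule execD[OF assms(2), where pre = "pre @ [Jump m n ?x]"])
      (auto simp: ifeq_def Let_def)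
  also have "reaches ?P p (?a + 1 + length ?D, t) (?x + length (c ?x), t)"
    by (intro reaches_step) (simp add: step_def halted_def nth_append ifeq_def Let_def)
  finally show "reaches ?P p (?a, s) (?a + length (ifeq m n c d ?a), t)"
    by (simp add: ifeq_def Let_def add.assoc)
qed

lemma exec_while_done:
  assumes "s m = s n"
  shows "exec p (while_neq m n c) s s"
  using assms unfolding exec_def
  by (auto intro!: reaches_step simp: step_def halted_def nth_append while_neq_def Let_def)

lemma exec_while_step:
  assumes "s m \<noteq> s n" "exec p c s s'" "exec p (while_neq m n c) s' t"
  shows "exec p (while_neq m n c) s t"
  unfolding exec_def
proof (intro allI)
  fix pre post :: "instr list"
  let ?a = "length pre"
  let ?P = "pre @ while_neq m n c ?a @ post"
  let ?C = "c (?a + 1)"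
  have "reaches ?P p (?a, s) (?a + 1, s)"
    using assms(1)
    by (intro reaches_step) (simp add: step_def halted_def nth_append while_neq_def Let_def)
  also have "reaches ?P p (?a + 1, s) (?a + 1 + length ?C, s')"
    by (rule execD[OF assms(2), where pre = "pre @ [Jump m n (?a + length ?C + 2)]"])
      (auto simp: while_neq_def Let_def)
  also have "reaches ?P p (?a + 1 + length ?C, s') (?a, s')"
    by (intro reaches_step) (simp add: step_def halted_def nth_append while_neq_def Let_def)
  also have "reaches ?P p (?a, s') (?a + length (while_neq m n c ?a), t)"
    by (rule execD[OF assms(3)]) auto
  finally show "reaches ?P p (?a, s) (?a + length (while_neq m n c ?a), t)" .
qed

text \<open>
  The form in which the loop of the simulator is used: its run is assembled from segments by
  transitivity.
\<close>
lemma exec_while_iterate: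
  assumes "(\<lambda>s t. s m \<noteq> s n \<and> exec p c s t)\<^sup>*\<^sup>* s t" "t m = t n"
  shows "exec p (while_neq m n c) s t"
  using assms(1)
  by (induction rule: converse_rtranclp_induct)
    (auto intro: exec_while_done exec_while_step assms(2))

lemma exec_Zero: "exec p (ins (Zero n)) s (s(n := 0))"
  and exec_Succ: "exec p (ins (Succ n)) s (s(n := Suc (s n)))"
  and exec_Transfer: "exec p (ins (Transfer m n)) s (s(n := s m))"
  and exec_Oracle: "exec p (ins (Oracle n)) s (s(n := p (s n)))"
  by (rule exec_ins, simp)+

section \<open>Procedures\<close>

text \<open>
  The argument of a procedure is the first register \<open>b\<close> that it may use. It expects its arguments in
  \<open>b, b + 1, \<dots>\<close>, leaves its result in \<open>b\<close> and spoils only registers from \<open>b\<close> on, so a caller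
  protects its own data by choosing \<open>b\<close> above it.
\<close>
type_synonym proc = "nat \<Rightarrow> code"

definition agree :: "nat \<Rightarrow> state \<Rightarrow> state \<Rightarrow> bool" where
  "agree w s t \<longleftrightarrow> (\<forall>i<w. s i = t i)"

text \<open>
  The registers above the arguments may hold anything at the call; procedures therefore clear
  their work registers themselves.
\<close>
definition calls :: "state \<Rightarrow> proc \<Rightarrow> nat list \<Rightarrow> nat \<Rightarrow> bool" where
  "calls p C xs y \<longleftrightarrow> (\<forall>b s. (\<forall>i<length xs. s (b + i) = xs ! i) \<longrightarrow>
     (\<exists>t. exec p (C b) s t \<and> agree b t s \<and> t b = y))"

lemma callsI:
  assumes "\<And>b s. (\<And>i. i < length xs \<Longrightarrow> s (b + i) = xs ! i) \<Longrightarrow>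
    \<exists>t. exec p (C b) s t \<and> agree b t s \<and> t b = y"
  shows "calls p C xs y"
  using assms unfolding calls_def by blast

lemma callsD:
  assumes "calls p C xs y" "\<And>i. i < length xs \<Longrightarrow> s (b + i) = xs ! i"
  obtains t where "exec p (C b) s t" "agree b t s" "t b = y"
  using assms unfolding calls_def by blast

lemma outputs_of_calls:
  assumes "calls p C xs y"
  shows "outputs (C 0 0) p xs y"
proof -
  let ?s = "snd (init_config xs)"
  obtain t where t: "exec p (C 0) ?s t" "t 0 = y"
    by (rule callsD[OF assms, of ?s 0]) (auto simp: init_config_def)
  have "reaches (C 0 0) p (0, ?s) (length (C 0 0), t)"
    using execD[OF t(1), where pre = "[]" and post = "[]"] by simp
  then obtain n where n: "(step (C 0 0) p ^^ n) (init_config xs) = (length (C 0 0), t)"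
    by (auto simp: reaches_def init_config_def)
  show ?thesis
    unfolding outputs_def by (rule exI[of _ n]) (simp add: n halted_def t(2))
qed

fun copy_to :: "nat list \<Rightarrow> nat \<Rightarrow> code" where
  "copy_to [] w = skip"
| "copy_to (x # xs) w = ins (Transfer x w) ;; copy_to xs (Suc w)"

lemma exec_copy_to:
  assumes "set args \<subseteq> {..<w}" "w \<le> w'"
  shows "\<exists>t. exec p (copy_to args w') s t \<and> agree w' t s \<and>
    (\<forall>i<length args. t (w' + i) = s (args ! i))"
  using assms
proof (induction args arbitrary: w' s)
  case Nil
  show ?case by (auto intro!: exI[of _ s] exec_skip simp: agree_def)
next
  case (Cons x xs)
  let ?s = "s(w' := s x)"
  have "set xs \<subseteq> {..<w}" "w \<le> Suc w'" using Cons.prems by auto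
  from Cons.IH[OF this, of ?s] obtain t where
    t: "exec p (copy_to xs (Suc w')) ?s t" "agree (Suc w') t ?s"
      "\<forall>i<length xs. t (Suc w' + i) = ?s (xs ! i)" by blast
  have "t (w' + i) = s ((x # xs) ! i)" if "i < length (x # xs)" for i
  proof (cases i)
    case 0
    then show ?thesis using t(2) by (simp add: agree_def)
  next
    case (Suc j)
    then have "xs ! j < w'" using that Cons.prems by (auto dest: nth_mem)
    then show ?thesis using Suc t(3) that by auto
  qed
  moreover have "agree w' t s" using t(2) by (simp add: agree_def)
  ultimately show ?case
    using exec_seqc[OF exec_Transfer t(1)] by auto
qed

definition call :: "proc \<Rightarrow> nat list \<Rightarrow> nat \<Rightarrow> nat \<Rightarrow> code" where
  "call C args dst w = copy_to args w ;; C w ;; ins (Transfer w dst)"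

lemma exec_call:
  assumes "calls p C (map s args) y" "set args \<subseteq> {..<w}" "dst < w"
  shows "\<exists>t. exec p (call C args dst w) s t \<and> agree w t (s(dst := y))"
proof -
  obtain s1 where s1: "exec p (copy_to args w) s s1" "agree w s1 s"
    "\<forall>i<length args. s1 (w + i) = s (args ! i)"
    using exec_copy_to[OF assms(2) order.refl] by blast
  obtain s2 where s2: "exec p (C w) s1 s2" "agree w s2 s1" "s2 w = y"
    by (rule callsD[OF assms(1), of s1 w]) (use s1(3) in auto)
  have "exec p (call C args dst w) s (s2(dst := s2 w))"
    unfolding call_def by (rule exec_seqc[OF s1(1) exec_seqc[OF s2(1) exec_Transfer]])
  moreover have "agree w (s2(dst := s2 w)) (s(dst := y))"
    using s1(2) s2(2,3) by (simp add: agree_def)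
  ultimately show ?thesis by blast
qed

subsection \<open>Composition and unbounded search\<close>

fun eval_args :: "nat list \<Rightarrow> nat \<Rightarrow> nat \<Rightarrow> proc list \<Rightarrow> code" where
  "eval_args args w dst [] = skip"
| "eval_args args w dst (G # Gs) = call G args dst w ;; eval_args args w (Suc dst) Gs"

lemma exec_eval_args:
  assumes "list_all2 (\<lambda>G. calls p G xs) Gs ys" "map s args = xs"
    "set args \<subseteq> {..<d}" "d \<le> dst" "dst + length Gs \<le> w"
  shows "\<exists>t. exec p (eval_args args w dst Gs) s t \<and> agree dst t s \<and>
    (\<forall>i<length ys. t (dst + i) = ys ! i)"
  using assms
proof (induction arbitrary: s dst)
  case Nil
  show ?case by (auto intro!: exI[of _ s] exec_skip simp: agree_def)
next
  case (Cons G Gs y ys)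
  have "calls p G (map s args) y" "set args \<subseteq> {..<w}" "dst < w"
    using Cons.hyps Cons.prems by auto
  from exec_call[OF this] obtain s1 where
    s1: "exec p (call G args dst w) s s1" "agree w s1 (s(dst := y))" by blast
  have "map s1 args = xs"
    using s1(2) Cons.prems by (fastforce simp: agree_def)
  from Cons.IH[OF this Cons.prems(2), of "Suc dst"] obtain t where
    t: "exec p (eval_args args w (Suc dst) Gs) s1 t"
      "agree (Suc dst) t s1" "\<forall>i<length ys. t (Suc dst + i) = ys ! i"
    using Cons.prems by auto
  have "t (dst + i) = (y # ys) ! i" if "i < length (y # ys)" for i
    using that t(2,3) s1(2) Cons.prems by (cases i) (auto simp: agree_def)
  moreover have "agree dst t s"
    using t(2) s1(2) Cons.prems by (auto simp: agree_def)
  ultimately show ?case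
    using exec_seqc[OF s1(1) t(1)] by auto
qed

text \<open>
  The arguments stay in \<open>b, \<dots>, b + n - 1\<close> while the intermediate results are collected above them.
\<close>
definition comp_proc :: "nat \<Rightarrow> proc \<Rightarrow> proc list \<Rightarrow> proc" where
  "comp_proc n F Gs b =
     (let d = b + n; w = d + length Gs
      in eval_args [b..<d] w d Gs ;; call F [d..<w] b w)"

lemma map_upt_eq: "(\<And>i. i < length xs \<Longrightarrow> s (b + i) = xs ! i) \<Longrightarrow> map s [b..<b + length xs] = xs"
  by (rule nth_equalityI) auto

lemma calls_comp:
  assumes G: "list_all2 (\<lambda>G. calls p G xs) Gs ys" and F: "calls p F ys z"
    and n: "n = length xs" and ne: "Gs \<noteq> [] \<or> xs \<noteq> []"
  shows "calls p (comp_proc n F Gs) xs z"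
proof (rule callsI)
  fix b s assume s: "\<And>i. i < length xs \<Longrightarrow> s (b + i) = xs ! i"
  let ?d = "b + n" and ?w = "b + n + length Gs"
  have len: "length Gs = length ys" using G by (rule list_all2_lengthD)
  have "map s [b..<?d] = xs" unfolding n by (rule map_upt_eq) (rule s)
  from exec_eval_args[OF G this, of ?d ?d ?w] obtain s1 where
    s1: "exec p (eval_args [b..<?d] ?w ?d Gs) s s1" "agree ?d s1 s"
      "\<forall>i<length ys. s1 (?d + i) = ys ! i" by fastforce
  have "map s1 [?d..<?w] = ys"
    using map_upt_eq[of ys s1 ?d] s1(3) len by simp
  with F n ne have "calls p F (map s1 [?d..<?w]) z" "set [?d..<?w] \<subseteq> {..<?w}" "b < ?w"
    by auto
  from exec_call[OF this] obtain t where
    t: "exec p (call F [?d..<?w] b ?w) s1 t" "agree ?w t (s1(b := z))" by blast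
  have "exec p (comp_proc n F Gs b) s t"
    unfolding comp_proc_def Let_def by (rule exec_seqc[OF s1(1) t(1)])
  moreover have "agree b t s" using t(2) s1(2) by (auto simp: agree_def)
  moreover have "t b = z" using t(2) n ne by (auto simp: agree_def)
  ultimately show "\<exists>t. exec p (comp_proc n F Gs b) s t \<and> agree b t s \<and> t b = z" by blast
qed

definition mu :: "nat \<Rightarrow> proc \<Rightarrow> proc" where
  "mu n F b =
     (let y = b + n; v = y + 1; z = y + 2; w = y + 3;
          test = call F (y # [b..<y]) v w
      in ins (Zero y) ;; ins (Zero z) ;; test ;;
         while_neq v z (ins (Succ y) ;; test) ;; ins (Transfer y b))"

text \<open>
  Values of \<open>F\<close> are required only up to the least zero. This matters for iteration, where the
  iterates of a partial function may be undefined beyond that point.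
\<close>
lemma calls_mu:
  assumes F: "\<And>j. j \<le> y \<Longrightarrow> calls p F (j # xs) (g j)"
    and least: "\<And>j. j < y \<Longrightarrow> g j \<noteq> 0" "g y = 0" and n: "n = length xs"
  shows "calls p (mu n F) xs y"
proof (rule callsI)
  fix b s assume s: "\<And>i. i < length xs \<Longrightarrow> s (b + i) = xs ! i"
  define Y where "Y = b + n"
  let ?test = "call F (Y # [b..<Y]) (Y + 1) (Y + 3)"
  let ?body = "ins (Succ Y) ;; ?test"
  let ?loop = "while_neq (Y + 1) (Y + 2) ?body"
  have test: "\<exists>t. exec p ?test u t \<and> agree Y t s \<and> t Y = j \<and> t (Y + 1) = g j \<and> t (Y + 2) = 0"
    if u: "agree Y u s" "u Y = j" "u (Y + 2) = 0" "j \<le> y" for u j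
  proof -
    have "map u [b..<Y] = xs"
      using map_upt_eq[of xs u b] u(1) s n by (auto simp: agree_def Y_def)
    then have "calls p F (map u (Y # [b..<Y])) (g j)" "set (Y # [b..<Y]) \<subseteq> {..<Y + 3}"
      "Y + 1 < Y + 3"
      using F u by auto
    from exec_call[OF this] obtain t where
      "exec p ?test u t" "agree (Y + 3) t (u(Y + 1 := g j))" by blast
    then show ?thesis using u by (auto simp: agree_def)
  qed
  have loop: "\<exists>t. exec p ?loop u t \<and> agree Y t s \<and> t Y = y"
    if "agree Y u s" "u Y = j" "u (Y + 1) = g j" "u (Y + 2) = 0" "j \<le> y" for u j
    using that
  proof (induction "y - j" arbitrary: u j)
    case 0
    then have "u (Y + 1) = u (Y + 2)" using least(2) by simp
    with exec_while_done[of u "Y + 1" "Y + 2" p ?body] 0 show ?case by auto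
  next
    case (Suc k)
    then have neq: "u (Y + 1) \<noteq> u (Y + 2)" using least(1) by simp
    let ?u = "u(Y := Suc j)"
    have le: "Suc j \<le> y" using Suc.hyps(2) by simp
    then obtain u' where u': "exec p ?test ?u u'" "agree Y u' s" "u' Y = Suc j"
      "u' (Y + 1) = g (Suc j)" "u' (Y + 2) = 0"
      using test[of ?u "Suc j"] Suc.prems by (auto simp: agree_def)
    have "exec p ?body u u'"
      using exec_seqc[OF exec_Succ[of p Y u]] u'(1) Suc.prems by simp
    moreover have "\<exists>t. exec p ?loop u' t \<and> agree Y t s \<and> t Y = y"
      by (rule Suc.hyps(1)[OF _ u'(2-5) le]) (use Suc.hyps(2) in simp)
    ultimately show ?case using exec_while_step[of u, OF neq] by blast
  qed
  let ?s0 = "s(Y := 0, Y + 2 := 0)"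
  obtain s1 where s1: "exec p ?test ?s0 s1" "agree Y s1 s" "s1 Y = 0"
    "s1 (Y + 1) = g 0" "s1 (Y + 2) = 0"
    using test[of ?s0 0] by (auto simp: agree_def)
  obtain s2 where s2: "exec p ?loop s1 s2" "agree Y s2 s" "s2 Y = y"
    using loop[OF s1(2-5)] by auto
  have "exec p (mu n F b) s (s2(b := s2 Y))"
    unfolding mu_def Let_def Y_def[symmetric]
    by (intro exec_seqc[OF exec_Zero] exec_seqc[OF s1(1)] exec_seqc[OF s2(1)] exec_Transfer)
  moreover have "agree b (s2(b := s2 Y)) s"
    using s2(2) by (auto simp: agree_def Y_def)
  ultimately show "\<exists>t. exec p (mu n F b) s t \<and> agree b t s \<and> t b = y"
    using s2(3) by auto
qed

subsection \<open>Basic procedures\<close>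

definition proj :: "nat \<Rightarrow> proc" where
  "proj i b = ins (Transfer (b + i) b)"

definition query :: proc where
  "query b = ins (Oracle b)"

fun const :: "nat \<Rightarrow> proc" where
  "const 0 b = ins (Zero b)"
| "const (Suc c) b = const c b ;; ins (Succ b)"

definition if_eq :: proc where
  "if_eq b = ifeq b (b + 1) (ins (Transfer (b + 2) b)) (ins (Transfer (b + 3) b))"

definition add :: proc where
  "add b = ins (Zero (b + 2)) ;;
     while_neq (b + 2) (b + 1) (ins (Succ b) ;; ins (Succ (b + 2)))"

lemma calls_proj: "i < length xs \<Longrightarrow> xs ! i = y \<Longrightarrow> calls p (proj i) xs y"
  unfolding proj_def
  by (rule callsI) (auto intro!: exI exec_Transfer simp: agree_def)

lemma calls_query: "calls p query [k] (p k)"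
  unfolding query_def
  by (rule callsI) (auto intro!: exI exec_Oracle simp: agree_def)

lemma exec_const: "exec p (const c b) s (s(b := c))"
proof (induction c)
  case 0
  show ?case unfolding const.simps by (rule exec_Zero)
next
  case (Suc c)
  from exec_seqc[OF this exec_Succ[of p b]]
  show ?case by (simp only: const.simps fun_upd_same fun_upd_upd)
qed

lemma calls_const: "calls p (const c) xs c"
  by (rule callsI) (auto intro!: exI exec_const simp: agree_def)

lemma calls_if_eq: "calls p if_eq [a, b, x, y] (if a = b then x else y)"
proof (rule callsI)
  fix d s assume "\<And>i. i < length [a, b, x, y] \<Longrightarrow> s (d + i) = [a, b, x, y] ! i"
  from this[of 0] this[of 1] this[of 2] this[of 3]
  have s: "s d = a" "s (d + 1) = b" "s (d + 2) = x" "s (d + 3) = y" by simp_all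
  show "\<exists>t. exec p (if_eq d) s t \<and> agree d t s \<and> t d = (if a = b then x else y)"
  proof (cases "a = b")
    case True
    then have "exec p (if_eq d) s (s(d := x))"
      unfolding if_eq_def using exec_ifeq_true[OF _ exec_Transfer[of p "d + 2" d s]] s by simp
    then show ?thesis using True by (auto simp: agree_def intro!: exI)
  next
    case False
    then have "exec p (if_eq d) s (s(d := y))"
      unfolding if_eq_def using exec_ifeq_false[OF _ exec_Transfer[of p "d + 3" d s]] s by simp
    then show ?thesis using False by (auto simp: agree_def intro!: exI)
  qed
qed

text \<open>
  The loop counts the third register up to the second summand; there is no decrement instruction.
\<close>
lemma calls_add: "calls p add [x, y] (x + y)"
proof (rule callsI)
  fix b s assume "\<And>i. i < length [x, y] \<Longrightarrow> s (b + i) = [x, y] ! i"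
  from this[of 0] this[of 1] have s: "s b = x" "s (b + 1) = y" by simp_all
  let ?body = "ins (Succ b) ;; ins (Succ (b + 2))"
  have loop: "\<exists>t. exec p (while_neq (b + 2) (b + 1) ?body) u t \<and> agree b t s \<and> t b = x + y"
    if "agree b u s" "u b = x + j" "u (b + 1) = y" "u (b + 2) = j" "j \<le> y" for u j
    using that
  proof (induction "y - j" arbitrary: u j)
    case 0
    then show ?case by (auto intro!: exI[of _ u] exec_while_done)
  next
    case (Suc k)
    let ?u = "u(b := Suc (u b), b + 2 := Suc (u (b + 2)))"
    have "exec p ?body u ?u"
      using exec_seqc[OF exec_Succ[of p b u] exec_Succ[of p "b + 2"]] by simp
    moreover have "\<exists>t. exec p (while_neq (b + 2) (b + 1) ?body) ?u t \<and> agree b t s \<and> t b = x + y"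
      by (rule Suc.hyps(1)[of "Suc j"]) (use Suc.hyps(2) Suc.prems in \<open>auto simp: agree_def\<close>)
    ultimately show ?case using exec_while_step[of u] Suc.hyps(2) Suc.prems(3,4) by force
  qed
  obtain t where "exec p (while_neq (b + 2) (b + 1) ?body) (s(b + 2 := 0)) t"
    "agree b t s" "t b = x + y"
    using loop[of "s(b + 2 := 0)" 0] s by (auto simp: agree_def)
  then show "\<exists>t. exec p (add b) s t \<and> agree b t s \<and> t b = x + y"
    unfolding add_def using exec_seqc[OF exec_Zero] by blast
qed

section \<open>Simulation of iterated oracle machines\<close>

text \<open>
  The number of registers that have to be reserved for simulating the instruction.
\<close>
fun reg_bound :: "instr \<Rightarrow> nat" where
  "reg_bound (Zero n) = Suc n"
| "reg_bound (Succ n) = Suc n"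
| "reg_bound (Transfer m n) = Suc (max m n)"
| "reg_bound (Jump m n a) = Suc (max m n)"
| "reg_bound (Oracle n) = Suc n"

fun zeros :: "nat list \<Rightarrow> code" where
  "zeros [] = skip"
| "zeros (x # xs) = ins (Zero x) ;; zeros xs"

lemma exec_zeros: "exec p (zeros xs) s (\<lambda>i. if i \<in> set xs then 0 else s i)"
proof (induction xs arbitrary: s)
  case Nil
  show ?case by (simp add: exec_skip)
next
  case (Cons x xs)
  have "(\<lambda>i. if i \<in> set (x # xs) then 0 else s i) =
    (\<lambda>i. if i \<in> set xs then 0 else (s(x := 0)) i)" by auto
  then show ?case
    using exec_seqc[OF exec_Zero Cons.IH[of "s(x := 0)"]] by simp
qed

text \<open>
  A stack is a number; pushing \<open>x\<close> on \<open>st\<close> gives \<open>J (x, st)\<close>, and the empty stack needs no code of its own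
  since the simulator knows how many frames it has pushed.
\<close>
definition encode :: "(nat \<times> nat \<Rightarrow> nat) \<Rightarrow> nat list \<Rightarrow> nat \<Rightarrow> nat" where
  "encode J = fold (\<lambda>x st. J (x, st))"

definition pairing_procs ::
  "state \<Rightarrow> (nat \<times> nat \<Rightarrow> nat) \<Rightarrow> proc \<Rightarrow> proc \<Rightarrow> proc \<Rightarrow> bool" where
  "pairing_procs p J C C1 C2 \<longleftrightarrow> (\<forall>x y. calls p C [x, y] (J (x, y)) \<and>
     calls p C1 [J (x, y)] x \<and> calls p C2 [J (x, y)] y)"

text \<open>
  The simulator works in the registers from \<open>b\<close> on. Register \<open>b\<close> holds the height \<open>e\<close> of the tower, the
  next \<open>N\<close> registers are those of the simulated program. Register \<open>DEPTH\<close> is the level \<open>u\<close> of the current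
  run: \<open>0\<close> for the program on top, \<open>e\<close> for a run that queries the true oracle. It is counted upwards
  and saved in the frames, so that it never has to be decremented.
\<close>
locale simulator =
  fixes b N :: nat and pair_proc fst_proc snd_proc :: proc
begin

abbreviation reg :: "nat \<Rightarrow> nat" where "reg i \<equiv> b + 1 + i"
abbreviation PC :: nat where "PC \<equiv> b + 1 + N"
abbreviation DEPTH :: nat where "DEPTH \<equiv> b + 2 + N"
abbreviation ANSWERED :: nat where "ANSWERED \<equiv> b + 3 + N"
abbreviation ANSWER :: nat where "ANSWER \<equiv> b + 4 + N"
abbreviation STACK :: nat where "STACK \<equiv> b + 5 + N"
abbreviation ZERO :: nat where "ZERO \<equiv> b + 6 + N"
abbreviation ONE :: nat where "ONE \<equiv> b + 7 + N"
abbreviation DONE :: nat where "DONE \<equiv> b + 8 + N"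
abbreviation ADDR :: nat where "ADDR \<equiv> b + 9 + N"
abbreviation FREE :: nat where "FREE \<equiv> b + 10 + N"

fun push :: "nat list \<Rightarrow> code" where
  "push [] = skip"
| "push (x # xs) = call pair_proc [x, STACK] STACK FREE ;; push xs"

fun pop :: "nat list \<Rightarrow> code" where
  "pop [] = skip"
| "pop (x # xs) = pop xs ;; call fst_proc [STACK] x FREE ;; call snd_proc [STACK] STACK FREE"

definition frame :: "nat list" where
  "frame = [reg 0..<reg N] @ [PC, DEPTH]"

text \<open>
  An oracle instruction above the bottom level is executed twice. The first time it pushes
  the frame, with the program counter still pointing at it, and starts a run on the queried number.
  When that run has ended, the frame is restored and \<open>ANSWERED\<close> is set, so the second execution
  only moves the answer into place.
\<close>
fun instr_code :: "instr \<Rightarrow> code" where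
  "instr_code (Zero n) = ins (Zero (reg n)) ;; ins (Succ PC)"
| "instr_code (Succ n) = ins (Succ (reg n)) ;; ins (Succ PC)"
| "instr_code (Transfer m n) = ins (Transfer (reg m) (reg n)) ;; ins (Succ PC)"
| "instr_code (Jump m n a) = ifeq (reg m) (reg n) (const a PC) (ins (Succ PC))"
| "instr_code (Oracle n) =
     ifeq ANSWERED ONE
       (ins (Transfer ANSWER (reg n)) ;; ins (Zero ANSWERED) ;; ins (Succ PC))
       (ifeq DEPTH b
         (ins (Oracle (reg n)) ;; ins (Succ PC))
         (push frame ;; ins (Transfer (reg n) (reg 0)) ;; zeros [reg 1..<reg N] ;;
          ins (Zero PC) ;; ins (Succ DEPTH)))"

text \<open>
  The machine cannot jump to a computed address; \<open>ADDR\<close> counts through the addresses of the program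
  until it meets \<open>PC\<close>. If \<open>PC\<close> is behind the end, the simulated program has halted and \<open>h\<close> is run.
\<close>
fun dispatch :: "code \<Rightarrow> instr list \<Rightarrow> code" where
  "dispatch h [] = h"
| "dispatch h (i # is) = ifeq PC ADDR (instr_code i) (ins (Succ ADDR) ;; dispatch h is)"

definition return :: code where
  "return = ins (Transfer (reg 0) ANSWER) ;; pop frame ;; ins (Transfer ONE ANSWERED)"

definition body :: "instr list \<Rightarrow> instr list \<Rightarrow> code" where
  "body Q P = ins (Zero ADDR) ;;
     ifeq DEPTH ZERO (dispatch (ins (Transfer ONE DONE)) Q) (dispatch return P)"

definition simulate :: "instr list \<Rightarrow> instr list \<Rightarrow> nat \<Rightarrow> code" where
  "simulate Q P m = zeros [reg m..<FREE] ;; ins (Succ ONE) ;;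
     while_neq DONE ONE (body Q P) ;; ins (Transfer (reg 0) b)"

text \<open>
  The invariant of the main loop: \<open>cf\<close> is the simulated configuration at level \<open>u\<close>, \<open>st\<close> the stack, \<open>a\<close> and
  \<open>v\<close> the answer flag and the answer, and the registers of the caller are as in \<open>s0\<close>. It ignores
  \<open>ADDR\<close> and everything above, which is scratch space.
\<close>
definition represents ::
  "state \<Rightarrow> nat \<Rightarrow> nat \<Rightarrow> nat \<Rightarrow> nat \<Rightarrow> nat \<Rightarrow> config \<Rightarrow> state \<Rightarrow> bool" where
  "represents s0 e u a v st cf s \<longleftrightarrow> agree b s s0 \<and> s b = e \<and> s DEPTH = u \<and>
     s ANSWERED = a \<and> s ANSWER = v \<and> s STACK = st \<and> s ZERO = 0 \<and> s ONE = 1 \<and>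
     s DONE = 0 \<and> s PC = fst cf \<and> (\<forall>i<N. s (reg i) = snd cf i)"

lemma represents_cong:
  "represents s0 e u a v st cf s \<Longrightarrow> agree ADDR t s \<Longrightarrow> represents s0 e u a v st cf t"
  by (simp add: represents_def agree_def)

lemma exec_push:
  assumes "pairing_procs p J pair_proc fst_proc snd_proc" "set xs \<subseteq> {..<STACK}"
  shows "\<exists>t. exec p (push xs) s t \<and>
    agree FREE t (s(STACK := encode J (map s xs) (s STACK)))"
  using assms(2)
proof (induction xs arbitrary: s)
  case Nil
  show ?case by (auto intro!: exI[of _ s] exec_skip simp: agree_def encode_def)
next
  case (Cons x xs)
  have "calls p pair_proc (map s [x, STACK]) (J (s x, s STACK))"
    "set [x, STACK] \<subseteq> {..<FREE}" "STACK < FREE"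
    using assms(1) Cons.prems by (auto simp: pairing_procs_def)
  from exec_call[OF this] obtain s1 where
    s1: "exec p (call pair_proc [x, STACK] STACK FREE) s s1"
      "agree FREE s1 (s(STACK := J (s x, s STACK)))" by blast
  from Cons.prems have "set xs \<subseteq> {..<STACK}" by simp
  from Cons.IH[OF this, of s1] obtain t where t: "exec p (push xs) s1 t"
    "agree FREE t (s1(STACK := encode J (map s1 xs) (s1 STACK)))" by blast
  have "map s1 xs = map s xs"
    using s1(2) Cons.prems by (fastforce simp: agree_def)
  moreover have "s1 STACK = J (s x, s STACK)" using s1(2) by (simp add: agree_def)
  ultimately have "encode J (map s1 xs) (s1 STACK) = encode J (map s (x # xs)) (s STACK)"
    by (simp only: encode_def list.map fold_simps)
  then have "agree FREE t (s(STACK := encode J (map s (x # xs)) (s STACK)))"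
    using t(2) s1(2) by (simp add: agree_def)
  moreover have "exec p (push (x # xs)) s t"
    unfolding push.simps by (rule exec_seqc[OF s1(1) t(1)])
  ultimately show ?case by blast
qed

text \<open>
  Popping restores the registers in the reverse order of pushing; \<open>f\<close> stands for the register contents
  at the time of the push.
\<close>
lemma exec_pop:
  assumes "pairing_procs p J pair_proc fst_proc snd_proc" "set xs \<subseteq> {..<STACK}"
    "s STACK = encode J (map f xs) st"
  shows "\<exists>t. exec p (pop xs) s t \<and>
    agree FREE t ((\<lambda>i. if i \<in> set xs then f i else s i)(STACK := st))"
  using assms(2,3)
proof (induction xs arbitrary: st)
  case Nil
  then show ?case by (auto intro!: exI[of _ s] exec_skip simp: agree_def encode_def)
next
  case (Cons x xs)
  have "set xs \<subseteq> {..<STACK}" "s STACK = encode J (map f xs) (J (f x, st))"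
    using Cons.prems by (auto simp: encode_def)
  from Cons.IH[OF this] obtain s1 where s1: "exec p (pop xs) s s1"
    "agree FREE s1 ((\<lambda>i. if i \<in> set xs then f i else s i)(STACK := J (f x, st)))" by blast
  have st: "s1 STACK = J (f x, st)" using s1(2) by (simp add: agree_def)
  have x: "x < STACK" using Cons.prems by simp
  have "calls p fst_proc (map s1 [STACK]) (f x)" "set [STACK] \<subseteq> {..<FREE}" "x < FREE"
    using assms(1) x by (auto simp: pairing_procs_def st)
  from exec_call[OF this] obtain s2 where
    s2: "exec p (call fst_proc [STACK] x FREE) s1 s2" "agree FREE s2 (s1(x := f x))" by blast
  have "s2 STACK = J (f x, st)" using s2(2) st x by (simp add: agree_def)
  then have "calls p snd_proc (map s2 [STACK]) st" "set [STACK] \<subseteq> {..<FREE}" "STACK < FREE"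
    using assms(1) by (auto simp: pairing_procs_def)
  from exec_call[OF this] obtain t where
    t: "exec p (call snd_proc [STACK] STACK FREE) s2 t" "agree FREE t (s2(STACK := st))"
    by blast
  have "agree FREE t ((\<lambda>i. if i \<in> set (x # xs) then f i else s i)(STACK := st))"
    using s1(2) s2(2) t(2) by (simp add: agree_def)
  moreover have "exec p (pop (x # xs)) s t"
    unfolding pop.simps by (rule exec_seqc[OF s1(1) exec_seqc[OF s2(1) t(1)]])
  ultimately show ?case by blast
qed

lemma exec_dispatch_hit:
  assumes "s PC = k + i" "s ADDR = k" "i < length is"
    "exec p (instr_code (is ! i)) (s(ADDR := k + i)) t"
  shows "exec p (dispatch h is) s t"
  using assms
proof (induction "is" arbitrary: s k i)
  case Nil
  then show ?case by simp
next
  case (Cons x xs)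
  show ?case
  proof (cases i)
    case 0
    then have "s(ADDR := k + i) = s" using Cons.prems by auto
    then have "exec p (instr_code x) s t" "s PC = s ADDR" using Cons.prems 0 by simp_all
    then show ?thesis unfolding dispatch.simps by (intro exec_ifeq_true)
  next
    case (Suc j)
    have x: "exec p (instr_code (xs ! j)) (s(ADDR := Suc (s ADDR), ADDR := Suc k + j)) t"
      using Cons.prems(4) Suc by (simp only: fun_upd_upd nth_Cons_Suc add_Suc add_Suc_right)
    have "exec p (dispatch h xs) (s(ADDR := Suc (s ADDR))) t"
      by (rule Cons.IH[OF _ _ _ x]) (use Cons.prems(1-3) Suc in simp_all)
    moreover have "s PC \<noteq> s ADDR" using Cons.prems Suc by simp
    ultimately show ?thesis
      unfolding dispatch.simps by (intro exec_ifeq_false exec_seqc[OF exec_Succ])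
  qed
qed

lemma exec_dispatch_miss:
  assumes "s PC = k + i" "s ADDR = k" "length is \<le> i"
    "exec p h (s(ADDR := k + length is)) t"
  shows "exec p (dispatch h is) s t"
  using assms
proof (induction "is" arbitrary: s k i)
  case Nil
  then have "s(ADDR := k + length ([] :: instr list)) = s" by auto
  then show ?case using Nil by simp
next
  case (Cons x xs)
  then obtain j where j: "i = Suc j" by (cases i) auto
  have h: "exec p h (s(ADDR := Suc (s ADDR), ADDR := Suc k + length xs)) t"
    using Cons.prems(4) by (simp only: fun_upd_upd list.size(4) add_Suc add_Suc_right add_0_right)
  have "exec p (dispatch h xs) (s(ADDR := Suc (s ADDR))) t"
    by (rule Cons.IH[OF _ _ _ h, where i = j]) (use Cons.prems(1-3) j in simp_all)
  moreover have "s PC \<noteq> s ADDR" using Cons.prems j by simp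
  ultimately show ?case
    unfolding dispatch.simps by (intro exec_ifeq_false exec_seqc[OF exec_Succ])
qed

lemma exec_instr_code:
  assumes "represents s0 e u 0 v st (c, r) s" "reg_bound i \<le> N" "\<And>n. i \<noteq> Oracle n"
  shows "\<exists>t. exec p (instr_code i) s t \<and> represents s0 e u 0 v st (exec_instr q i (c, r)) t"
proof (cases i)
  case (Zero n)
  have "represents s0 e u 0 v st (exec_instr q i (c, r)) (s(reg n := 0, PC := Suc (s PC)))"
    using assms Zero by (auto simp: represents_def agree_def)
  then show ?thesis
    using exec_seqc[OF exec_Zero[of p "reg n" s] exec_Succ[of p PC]] assms(2) Zero by auto
next
  case (Succ n)
  have "represents s0 e u 0 v st (exec_instr q i (c, r))
      (s(reg n := Suc (s (reg n)), PC := Suc (s PC)))"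
    using assms Succ by (auto simp: represents_def agree_def)
  then show ?thesis
    using exec_seqc[OF exec_Succ[of p "reg n" s] exec_Succ[of p PC]] assms(2) Succ by auto
next
  case (Transfer m n)
  with assms(2) have "m < N" "n < N" by simp_all
  have "represents s0 e u 0 v st (exec_instr q i (c, r))
      (s(reg n := s (reg m), PC := Suc (s PC)))"
    using assms Transfer by (auto simp: represents_def agree_def)
  then show ?thesis
    using exec_seqc[OF exec_Transfer[of p "reg m" "reg n" s] exec_Succ[of p PC]] \<open>n < N\<close> Transfer
    by auto
next
  case (Jump m n a)
  then have r: "s (reg m) = r m" "s (reg n) = r n"
    using assms by (auto simp: represents_def)
  show ?thesis
  proof (cases "r m = r n")
    case True
    have "represents s0 e u 0 v st (exec_instr q i (c, r)) (s(PC := a))"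
      using assms Jump True by (auto simp: represents_def agree_def)
    moreover have "exec p (instr_code i) s (s(PC := a))"
      unfolding Jump instr_code.simps using exec_ifeq_true[OF _ exec_const] True r by metis
    ultimately show ?thesis by blast
  next
    case False
    have "represents s0 e u 0 v st (exec_instr q i (c, r)) (s(PC := Suc (s PC)))"
      using assms Jump False by (auto simp: represents_def agree_def)
    moreover have "exec p (instr_code i) s (s(PC := Suc (s PC)))"
      unfolding Jump instr_code.simps using exec_ifeq_false[OF _ exec_Succ] False r by metis
    ultimately show ?thesis by blast
  qed
next
  case (Oracle n)
  then show ?thesis using assms by simp
qed

lemma exec_oracle_bottom:
  assumes "represents s0 e e 0 v st (c, r) s" "n < N"
  shows "\<exists>t. exec p (instr_code (Oracle n)) s t \<and>
    represents s0 e e 0 v st (exec_instr p (Oracle n) (c, r)) t"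
proof -
  let ?t = "s(reg n := p (s (reg n)), PC := Suc (s PC))"
  have "exec p (ins (Oracle (reg n)) ;; ins (Succ PC)) s ?t"
    using exec_seqc[OF exec_Oracle[of p "reg n" s] exec_Succ[of p PC]] assms(2) by simp
  moreover have "s DEPTH = s b" "s ANSWERED \<noteq> s ONE"
    using assms(1) by (auto simp: represents_def)
  ultimately have "exec p (instr_code (Oracle n)) s ?t"
    unfolding instr_code.simps by (intro exec_ifeq_false exec_ifeq_true)
  moreover have "represents s0 e e 0 v st (exec_instr p (Oracle n) (c, r)) ?t"
    using assms by (auto simp: represents_def agree_def)
  ultimately show ?thesis by blast
qed

lemma exec_oracle_answered:
  assumes "represents s0 e u 1 (q (r n)) st (c, r) s" "n < N"
  shows "\<exists>t. exec p (instr_code (Oracle n)) s t \<and>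
    represents s0 e u 0 (q (r n)) st (exec_instr q (Oracle n) (c, r)) t"
proof -
  let ?t = "s(reg n := s ANSWER, ANSWERED := 0, PC := Suc (s PC))"
  have "exec p (ins (Transfer ANSWER (reg n)) ;; ins (Zero ANSWERED) ;; ins (Succ PC)) s ?t"
    using exec_seqc[OF exec_Transfer[of p ANSWER "reg n" s]
        exec_seqc[OF exec_Zero[of p ANSWERED] exec_Succ[of p PC]]] assms(2) by simp
  moreover have "s ANSWERED = s ONE"
    using assms(1) by (auto simp: represents_def)
  ultimately have "exec p (instr_code (Oracle n)) s ?t"
    unfolding instr_code.simps by (intro exec_ifeq_true)
  moreover have "represents s0 e u 0 (q (r n)) st (exec_instr q (Oracle n) (c, r)) ?t"
    using assms by (auto simp: represents_def agree_def)
  ultimately show ?thesis by blast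
qed

abbreviation frame_values :: "nat \<Rightarrow> config \<Rightarrow> nat list" where
  "frame_values u cf \<equiv> map (snd cf) [0..<N] @ [fst cf, u]"

lemma map_frame:
  assumes "represents s0 e u a v st cf s"
  shows "map s frame = frame_values u cf"
proof -
  have "map s [reg 0..<reg N] = map (snd cf) [0..<N]"
    using assms by (intro nth_equalityI) (auto simp: represents_def simp del: upt_Suc)
  then show ?thesis using assms by (simp add: frame_def represents_def)
qed

lemma exec_oracle_query:
  assumes "represents s0 e u 0 v st (c, r) s" "n < N" "u \<noteq> e"
    and J: "pairing_procs p J pair_proc fst_proc snd_proc"
  shows "\<exists>t. exec p (instr_code (Oracle n)) s t \<and>
    represents s0 e (Suc u) 0 v (encode J (frame_values u (c, r)) st) (init_config [r n]) t"
proof -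
  let ?st = "encode J (frame_values u (c, r)) st"
  have "set frame \<subseteq> {..<STACK}" by (auto simp: frame_def)
  from exec_push[OF J this, of s] obtain s1 where s1: "exec p (push frame) s s1"
    "agree FREE s1 (s(STACK := encode J (map s frame) (s STACK)))" by blast
  have "map s frame = frame_values u (c, r)" using map_frame assms(1) by blast
  moreover have "s STACK = st" using assms(1) by (simp add: represents_def)
  ultimately have agree1: "agree FREE s1 (s(STACK := ?st))" using s1(2) by metis
  let ?s2 = "s1(reg 0 := s1 (reg n))"
  let ?s3 = "\<lambda>i. if i \<in> set [reg 1..<reg N] then 0 else ?s2 i"
  let ?t = "?s3(PC := 0, DEPTH := Suc ((?s3(PC := 0)) DEPTH))"
  have "exec p (push frame ;; ins (Transfer (reg n) (reg 0)) ;; zeros [reg 1..<reg N] ;;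
      ins (Zero PC) ;; ins (Succ DEPTH)) s ?t"
    by (rule exec_seqc[OF s1(1) exec_seqc[OF exec_Transfer exec_seqc[OF exec_zeros
            exec_seqc[OF exec_Zero exec_Succ]]]])
  moreover have "s DEPTH \<noteq> s b" "s ANSWERED \<noteq> s ONE"
    using assms(1,3) by (auto simp: represents_def)
  ultimately have "exec p (instr_code (Oracle n)) s ?t"
    unfolding instr_code.simps by (intro exec_ifeq_false)
  moreover have "represents s0 e (Suc u) 0 v ?st (init_config [r n]) ?t"
    using assms(1,2) agree1
    by (auto simp: represents_def agree_def init_config_def simp del: upt_Suc)
  ultimately show ?thesis by blast
qed

lemma exec_return:
  assumes "represents s0 e (Suc u) 0 v (encode J (frame_values u (c, r)) st) cf s" "0 < N"
    and J: "pairing_procs p J pair_proc fst_proc snd_proc"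
  shows "\<exists>t. exec p return s t \<and> represents s0 e u 1 (snd cf 0) st (c, r) t"
proof -
  let ?f = "\<lambda>i. if i = DEPTH then u else if i = PC then c else r (i - (b + 1))"
  let ?s1 = "s(ANSWER := s (reg 0))"
  have "set frame \<subseteq> {..<STACK}" by (auto simp: frame_def)
  moreover have "map ?f frame = frame_values u (c, r)"
    by (auto simp: frame_def nth_append intro!: nth_equalityI simp del: upt_Suc)
  then have "?s1 STACK = encode J (map ?f frame) st"
    using assms(1) by (simp add: represents_def)
  ultimately obtain s2 where s2: "exec p (pop frame) ?s1 s2"
    "agree FREE s2 ((\<lambda>i. if i \<in> set frame then ?f i else ?s1 i)(STACK := st))"
    using exec_pop[OF J, of frame ?s1 ?f st] by blast
  have "exec p return s (s2(ANSWERED := s2 ONE))"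
    unfolding return_def
    by (rule exec_seqc[OF exec_Transfer exec_seqc[OF s2(1) exec_Transfer]])
  moreover have "represents s0 e u 1 (snd cf 0) st (c, r) (s2(ANSWERED := s2 ONE))"
    using assms(1,2) s2(2) by (auto simp: represents_def agree_def frame_def)
  ultimately show ?thesis by blast
qed

lemma exec_body:
  assumes rep: "represents s0 e u a v st (c, r) s" "c < length R" "R = (if u = 0 then Q else P)"
    and i: "\<And>s. represents s0 e u a v st (c, r) s \<Longrightarrow>
      \<exists>t. exec p (instr_code (R ! c)) s t \<and> represents s0 e' u' a' v' st' cf' t"
  shows "\<exists>t. exec p (body Q P) s t \<and> represents s0 e' u' a' v' st' cf' t"
proof -
  let ?s = "s(ADDR := 0)"
  have "represents s0 e u a v st (c, r) (s(ADDR := c))"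
    by (rule represents_cong[OF rep(1)]) (simp add: agree_def)
  from i[OF this] obtain t where t: "exec p (instr_code (R ! c)) (s(ADDR := c)) t"
    "represents s0 e' u' a' v' st' cf' t" by blast
  have hit: "exec p (dispatch h R) ?s t" for h
    by (rule exec_dispatch_hit[of _ 0 c]) (use rep t in \<open>auto simp: represents_def\<close>)
  have "exec p (ifeq DEPTH ZERO (dispatch (ins (Transfer ONE DONE)) Q) (dispatch return P)) ?s t"
  proof (cases "u = 0")
    case True
    then show ?thesis
      using rep hit by (intro exec_ifeq_true) (auto simp: represents_def)
  next
    case False
    then show ?thesis
      using rep hit by (intro exec_ifeq_false) (auto simp: represents_def)
  qed
  from exec_seqc[OF exec_Zero this] t(2) show ?thesis unfolding body_def by blast
qed

text \<open>
  A halted run below the top hands its result to the suspended run, whose program counter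
  still points at the query.
\<close>
lemma exec_body_return:
  assumes rep: "represents s0 e (Suc u) 0 v (encode J (frame_values u (c, r)) st) cf s"
    and "0 < N" "halted P cf"
    and J: "pairing_procs p J pair_proc fst_proc snd_proc"
  shows "\<exists>t. exec p (body Q P) s t \<and> represents s0 e u 1 (snd cf 0) st (c, r) t"
proof -
  let ?s = "s(ADDR := 0)"
  have "represents s0 e (Suc u) 0 v (encode J (frame_values u (c, r)) st) cf
      (s(ADDR := length P))"
    by (rule represents_cong[OF rep]) (simp add: agree_def)
  from exec_return[OF this assms(2) J] obtain t where
    t: "exec p return (s(ADDR := length P)) t" "represents s0 e u 1 (snd cf 0) st (c, r) t"
    by blast
  have "exec p (dispatch return P) ?s t"
    by (rule exec_dispatch_miss[of _ 0 "fst cf"])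
      (use rep t assms(3) in \<open>auto simp: represents_def halted_def\<close>)
  then have "exec p (ifeq DEPTH ZERO (dispatch (ins (Transfer ONE DONE)) Q)
      (dispatch return P)) ?s t"
    using rep by (intro exec_ifeq_false) (auto simp: represents_def)
  from exec_seqc[OF exec_Zero this] t(2) show ?thesis unfolding body_def by blast
qed

lemma exec_body_done:
  assumes rep: "represents s0 e 0 0 v st cf s" and "halted Q cf"
  shows "exec p (body Q P) s (s(ADDR := length Q, DONE := 1))"
proof -
  let ?s = "s(ADDR := 0)"
  have "s ONE = 1" using rep by (simp add: represents_def)
  then have "exec p (ins (Transfer ONE DONE)) (s(ADDR := length Q))
      (s(ADDR := length Q, DONE := 1))"
    using exec_Transfer[of p ONE DONE "s(ADDR := length Q)"] by simp
  then have "exec p (dispatch (ins (Transfer ONE DONE)) Q) ?s (s(ADDR := length Q, DONE := 1))"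
    by (intro exec_dispatch_miss[of _ 0 "fst cf"])
      (use rep assms(2) in \<open>auto simp: represents_def halted_def\<close>)
  then have "exec p (ifeq DEPTH ZERO (dispatch (ins (Transfer ONE DONE)) Q)
      (dispatch return P)) ?s (s(ADDR := length Q, DONE := 1))"
    using rep by (intro exec_ifeq_true) (auto simp: represents_def)
  from exec_seqc[OF exec_Zero this] show ?thesis unfolding body_def .
qed

abbreviation loop_step :: "state \<Rightarrow> instr list \<Rightarrow> instr list \<Rightarrow> state \<Rightarrow> state \<Rightarrow> bool" where
  "loop_step p Q P \<equiv> \<lambda>s t. s DONE \<noteq> s ONE \<and> exec p (body Q P) s t"

lemma loop_stepI:
  "represents s0 e u a v st cf s \<Longrightarrow> exec p (body Q P) s t \<Longrightarrow> loop_step p Q P s t"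
  by (simp add: represents_def)

lemma loop_once:
  assumes "represents s0 e u a v st cf s"
    and "\<exists>t. exec p (body Q P) s t \<and> represents s0 e' u' a' v' st' cf' t"
  shows "\<exists>t v'. (loop_step p Q P)\<^sup>*\<^sup>* s t \<and> represents s0 e' u' a' v' st' cf' t"
proof -
  obtain t where t: "exec p (body Q P) s t" "represents s0 e' u' a' v' st' cf' t"
    using assms(2) by (elim exE conjE)
  have "(loop_step p Q P)\<^sup>*\<^sup>* s t"
    by (rule r_into_rtranclp) (rule loop_stepI[OF assms(1) t(1)])
  with t(2) show ?thesis by (intro exI conjI)
qed

text \<open>
  Reduces the simulation of a run at one level to the simulation of its individual instructions.
\<close>
lemma loop_simulates_run:
  assumes rep: "represents s0 e u 0 v st cf s"
    and instr: "\<And>c r v s. represents s0 e u 0 v st (c, r) s \<Longrightarrow> c < length R \<Longrightarrow>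
      \<exists>t v'. (loop_step p Q P)\<^sup>*\<^sup>* s t \<and>
        represents s0 e u 0 v' st (exec_instr q (R ! c) (c, r)) t"
  shows "\<exists>t v'. (loop_step p Q P)\<^sup>*\<^sup>* s t \<and> represents s0 e u 0 v' st ((step R q ^^ n) cf) t"
proof (induction n)
  case 0
  show ?case using rep by auto
next
  case (Suc n)
  then obtain t v' where t: "(loop_step p Q P)\<^sup>*\<^sup>* s t"
    "represents s0 e u 0 v' st ((step R q ^^ n) cf) t" by blast
  obtain c r where cr: "(step R q ^^ n) cf = (c, r)" by fastforce
  show ?case
  proof (cases "c < length R")
    case False
    then have "(step R q ^^ Suc n) cf = (step R q ^^ n) cf"
      by (simp add: cr step_def halted_def)
    then show ?thesis using t by auto
  next
    case True
    then have "(step R q ^^ Suc n) cf = exec_instr q (R ! c) (c, r)"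
      by (simp add: cr step_def halted_def)
    moreover have "represents s0 e u 0 v' st (c, r) t" using t(2) cr by simp
    from instr[OF this True] obtain t' v'' where t': "(loop_step p Q P)\<^sup>*\<^sup>* t t'"
      "represents s0 e u 0 v'' st (exec_instr q (R ! c) (c, r)) t'" by blast
    moreover note rtranclp_trans[OF t(1) t'(1)]
    ultimately show ?thesis by auto
  qed
qed

text \<open>
  The oracle seen at level \<open>u = e - d\<close> is \<open>q d\<close>, the \<open>d\<close>-th sequence of the tower. The induction is on \<open>d\<close>:
  a query to \<open>q d\<close> with \<open>d > 0\<close> is answered by a complete run of \<open>P\<close> one level down with oracle \<open>q (d - 1)\<close>,
  and leaves the stack as it was. Pairing procedures are demanded only if there are queries to
  suspend, since they are themselves built from towers of height \<open>0\<close>.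
\<close>
lemma simulate_level:
  assumes Q: "\<forall>i\<in>set Q. reg_bound i \<le> N" and P: "\<forall>i\<in>set P. reg_bound i \<le> N" and N: "0 < N"
    and J: "e = 0 \<or> pairing_procs p J pair_proc fst_proc snd_proc"
    and q: "q 0 = p" "\<And>i k. i < e \<Longrightarrow> outputs P (q i) [k] (q (Suc i) k)"
    and rep: "represents s0 e u 0 v st cf s" and u: "u = e - d" "d \<le> e"
    and R: "R = (if u = 0 then Q else P)"
  shows "\<exists>t v'. (loop_step p Q P)\<^sup>*\<^sup>* s t \<and>
    represents s0 e u 0 v' st ((step R (q d) ^^ n) cf) t"
  using rep u R
proof (induction d arbitrary: n u v st cf s R rule: less_induct)
  case (less d)
  note R = \<open>R = (if u = 0 then Q else P)\<close>
  show ?case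
  proof (rule loop_simulates_run[OF less(2)])
    fix c r v s
    assume rep: "represents s0 e u 0 v st (c, r) s" and c: "c < length R"
    have bnd: "reg_bound (R ! c) \<le> N" using c Q P R by auto
    show "\<exists>t v'. (loop_step p Q P)\<^sup>*\<^sup>* s t \<and>
        represents s0 e u 0 v' st (exec_instr (q d) (R ! c) (c, r)) t"
    proof (cases "\<exists>m. R ! c = Oracle m")
      case False
      have "\<exists>t. exec p (body Q P) s t \<and>
          represents s0 e u 0 v st (exec_instr (q d) (R ! c) (c, r)) t"
        by (rule exec_body[OF rep c R], rule exec_instr_code[OF _ bnd]) (use False in auto)
      then show ?thesis by (rule loop_once[OF rep])
    next
      case True
      then obtain m where m: "R ! c = Oracle m" by blast
      then have mN: "m < N" using bnd by simp
      show ?thesis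
      proof (cases d)
        case 0
        then have "u = e" using less.prems by simp
        have "\<exists>t. exec p (body Q P) s t \<and>
            represents s0 e u 0 v st (exec_instr (q d) (R ! c) (c, r)) t"
          by (rule exec_body[OF rep c R])
            (unfold m 0 q(1) \<open>u = e\<close>, rule exec_oracle_bottom[OF _ mN])
        then show ?thesis by (rule loop_once[OF rep])
      next
        case (Suc d')
        have J: "pairing_procs p J pair_proc fst_proc snd_proc" using J less.prems Suc by auto
        have u: "Suc u = e - d'" "d' \<le> e" "u \<noteq> e" "d' < e" "d' < d" using less.prems Suc by auto
        \<comment> \<open>The run is suspended (\<open>t1\<close>), the run one level down is completed (\<open>t2\<close>), its result is
          returned (\<open>t3\<close>), and the query is executed again with the answer at hand (\<open>t4\<close>).\<close>
        let ?st = "encode J (frame_values u (c, r)) st"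
        have "\<exists>t. exec p (body Q P) s t \<and>
            represents s0 e (Suc u) 0 v ?st (init_config [r m]) t"
          by (rule exec_body[OF rep c R]) (unfold m, rule exec_oracle_query[OF _ mN u(3) J])
        then obtain t1 where t1: "exec p (body Q P) s t1"
          "represents s0 e (Suc u) 0 v ?st (init_config [r m]) t1" by blast
        have "outputs P (q d') [r m] (q d (r m))" using q(2)[OF u(4)] Suc by simp
        then obtain k where k: "halted P ((step P (q d') ^^ k) (init_config [r m]))"
          "snd ((step P (q d') ^^ k) (init_config [r m])) 0 = q d (r m)"
          unfolding outputs_def by (elim exE conjE)
        have "\<exists>t v'. (loop_step p Q P)\<^sup>*\<^sup>* t1 t \<and>
            represents s0 e (Suc u) 0 v' ?st ((step P (q d') ^^ k) (init_config [r m])) t"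
          by (rule less.IH[OF u(5) t1(2) u(1,2)]) simp
        then obtain t2 v2 where t2: "(loop_step p Q P)\<^sup>*\<^sup>* t1 t2"
          "represents s0 e (Suc u) 0 v2 ?st ((step P (q d') ^^ k) (init_config [r m])) t2"
          by blast
        obtain t3 where t3: "exec p (body Q P) t2 t3"
          "represents s0 e u 1 (q d (r m)) st (c, r) t3"
          using exec_body_return[OF t2(2) N k(1) J, of Q] unfolding k(2) by (elim exE conjE)
        have "\<exists>t. exec p (body Q P) t3 t \<and>
            represents s0 e u 0 (q d (r m)) st (exec_instr (q d) (R ! c) (c, r)) t"
          by (rule exec_body[OF t3(2) c R]) (unfold m, rule exec_oracle_answered[OF _ mN, where q = "q d"])
        then obtain t4 where t4: "exec p (body Q P) t3 t4"
          "represents s0 e u 0 (q d (r m)) st (exec_instr (q d) (R ! c) (c, r)) t4" by blast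
        have "(loop_step p Q P)\<^sup>*\<^sup>* s t2"
          by (rule converse_rtranclp_into_rtranclp[OF _ t2(1)]) (rule loop_stepI[OF rep t1(1)])
        then have "(loop_step p Q P)\<^sup>*\<^sup>* s t3"
          by (rule rtranclp.rtrancl_into_rtrancl) (rule loop_stepI[OF t2(2) t3(1)])
        then have "(loop_step p Q P)\<^sup>*\<^sup>* s t4"
          by (rule rtranclp.rtrancl_into_rtrancl) (rule loop_stepI[OF t3(2) t4(1)])
        then show ?thesis using t4(2) by (intro exI conjI)
      qed
    qed
  qed
qed

lemma exec_simulate:
  assumes Q: "\<forall>i\<in>set Q. reg_bound i \<le> N" and P: "\<forall>i\<in>set P. reg_bound i \<le> N"
    and N: "length xs < N"
    and J: "e = 0 \<or> pairing_procs p J pair_proc fst_proc snd_proc"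
    and q: "q 0 = p" "\<And>i k. i < e \<Longrightarrow> outputs P (q i) [k] (q (Suc i) k)"
    and out: "outputs Q (q e) xs y"
    and s: "s b = e" "\<And>i. i < length xs \<Longrightarrow> s (reg i) = xs ! i"
  shows "\<exists>t. exec p (simulate Q P (length xs)) s t \<and> agree b t s \<and> t b = y"
proof -
  let ?s1 = "\<lambda>i. if i \<in> set [reg (length xs)..<FREE] then 0 else s i"
  let ?s2 = "?s1(ONE := Suc (?s1 ONE))"
  obtain n where n: "halted Q ((step Q (q e) ^^ n) (init_config xs))"
    "snd ((step Q (q e) ^^ n) (init_config xs)) 0 = y"
    using out unfolding outputs_def by blast
  have N0: "0 < N" using N by simp
  have init: "represents s e 0 0 0 0 (init_config xs) ?s2"
    using s N by (auto simp: represents_def agree_def init_config_def simp del: upt_Suc)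
  have "\<exists>t v. (loop_step p Q P)\<^sup>*\<^sup>* ?s2 t \<and>
      represents s e 0 0 v 0 ((step Q (q e) ^^ n) (init_config xs)) t"
    by (rule simulate_level[where q = q, OF Q P N0 J q(1) _ init]) (simp_all add: q(2))
  then obtain t v where t: "(loop_step p Q P)\<^sup>*\<^sup>* ?s2 t"
    "represents s e 0 0 v 0 ((step Q (q e) ^^ n) (init_config xs)) t" by (elim exE conjE)
  let ?t1 = "t(ADDR := length Q, DONE := 1)"
  have "(loop_step p Q P)\<^sup>*\<^sup>* ?s2 ?t1"
    by (rule rtranclp.rtrancl_into_rtrancl[OF t(1)])
      (rule loop_stepI[OF t(2) exec_body_done[OF t(2) n(1)]])
  then have "exec p (while_neq DONE ONE (body Q P)) ?s2 ?t1"
    by (rule exec_while_iterate[of DONE ONE]) (use t(2) in \<open>simp add: represents_def\<close>)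
  then have "exec p (simulate Q P (length xs)) s (?t1(b := ?t1 (reg 0)))"
    unfolding simulate_def
    by (intro exec_seqc[OF exec_zeros exec_seqc[OF exec_Succ exec_seqc[OF _ exec_Transfer]]])
  moreover have "agree b (?t1(b := ?t1 (reg 0))) s" "?t1 (reg 0) = y"
    using t(2) n(2) N0 by (auto simp: represents_def agree_def)
  ultimately show ?thesis by (intro exI[of _ "?t1(b := ?t1 (reg 0))"]) simp
qed

end

definition tower_proc :: "proc \<Rightarrow> proc \<Rightarrow> proc \<Rightarrow> instr list \<Rightarrow> instr list \<Rightarrow> nat \<Rightarrow> proc" where
  "tower_proc C C1 C2 Q P n b =
     simulator.simulate b (Suc n + sum_list (map reg_bound (Q @ P))) C C1 C2 Q P n"

text \<open>
  The program \<open>Q\<close> is run with the oracle \<open>q e\<close>, although only \<open>q 0 = p\<close> is available, given that \<open>P\<close> computes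
  each \<open>q (Suc i)\<close> from \<open>q i\<close>. The height \<open>e\<close> is an ordinary argument.
\<close>
lemma calls_tower:
  assumes J: "e = 0 \<or> pairing_procs p J C C1 C2"
    and q: "q 0 = p" "\<And>i k. i < e \<Longrightarrow> outputs P (q i) [k] (q (Suc i) k)"
    and out: "outputs Q (q e) xs y" and n: "n = length xs"
  shows "calls p (tower_proc C C1 C2 Q P n) (e # xs) y"
proof (rule callsI)
  fix b s assume s: "\<And>i. i < length (e # xs) \<Longrightarrow> s (b + i) = (e # xs) ! i"
  let ?N = "Suc n + sum_list (map reg_bound (Q @ P))"
  have "reg_bound i \<le> ?N" if "i \<in> set (Q @ P)" for i
    by (rule trans_le_add2, rule member_le_sum_list) (use that in auto)
  then have bound: "\<forall>i\<in>set Q. reg_bound i \<le> ?N" "\<forall>i\<in>set P. reg_bound i \<le> ?N"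
    by simp_all
  have N: "length xs < ?N" using n by simp
  have "\<exists>t. exec p (simulator.simulate b ?N C C1 C2 Q P (length xs)) s t \<and>
      agree b t s \<and> t b = y"
  proof (rule simulator.exec_simulate[where q = q, OF bound N J _ _ out])
    show "q 0 = p" by (rule q)
    show "outputs P (q i) [k] (q (Suc i) k)" if "i < e" for i k using that by (rule q)
    show "s b = e" using s[of 0] by simp
    show "s (b + 1 + i) = xs ! i" if "i < length xs" for i
      using s[of "Suc i"] that by simp
  qed
  then show "\<exists>t. exec p (tower_proc C C1 C2 Q P n b) s t \<and> agree b t s \<and> t b = y"
    unfolding tower_proc_def n .
qed

section \<open>Arithmetic\<close>

definition double_proc :: proc where
  "double_proc = comp_proc 1 add [proj 0, proj 0]"

text \<open>
  The least \<open>y\<close> with \<open>2 y = x\<close> or \<open>2 y + 1 = x\<close>.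
\<close>
definition half_proc :: proc where
  "half_proc = mu 1 (comp_proc 2 if_eq [comp_proc 2 double_proc [proj 0], proj 1, const 0,
     comp_proc 2 if_eq [comp_proc 2 (comp_proc 1 add [double_proc, const 1]) [proj 0],
       proj 1, const 0, const 1]])"

definition parity_proc :: proc where
  "parity_proc =
     comp_proc 1 if_eq [comp_proc 1 double_proc [half_proc], proj 0, const 0, const 1]"

lemma calls_comp1:
  "calls p G xs x \<Longrightarrow> calls p F [x] z \<Longrightarrow> n = length xs \<Longrightarrow> calls p (comp_proc n F [G]) xs z"
  by (rule calls_comp[where ys = "[x]"]) auto

lemma calls_comp2:
  "calls p G xs x \<Longrightarrow> calls p H xs y \<Longrightarrow> calls p F [x, y] z \<Longrightarrow> n = length xs \<Longrightarrow>
   calls p (comp_proc n F [G, H]) xs z"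
  by (rule calls_comp[where ys = "[x, y]"]) auto

lemma calls_cond:
  assumes "calls p A xs a" "calls p B xs b" "calls p G xs x" "calls p H xs y" "n = length xs"
    "z = (if a = b then x else y)"
  shows "calls p (comp_proc n if_eq [A, B, G, H]) xs z"
  unfolding assms(6)
  by (rule calls_comp[OF _ calls_if_eq]) (use assms in simp_all)

lemma calls_double: "calls p double_proc [x] (2 * x)"
  unfolding double_proc_def mult_2
  by (rule calls_comp2 calls_proj calls_add | simp)+

lemma calls_half: "calls p half_proc [x] (x div 2)"
proof -
  let ?g = "\<lambda>j. if 2 * j = x then 0 else if 2 * j + 1 = x then 0 else 1 :: nat"
  show ?thesis
    unfolding half_proc_def
  proof (rule calls_mu[where g = ?g])
    fix j
    show "calls p (comp_proc 2 if_eq [comp_proc 2 double_proc [proj 0], proj 1, const 0,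
       comp_proc 2 if_eq [comp_proc 2 (comp_proc 1 add [double_proc, const 1]) [proj 0],
         proj 1, const 0, const 1]]) [j, x] (?g j)"
      by (rule calls_cond calls_comp1 calls_comp2 calls_const calls_double calls_add
          calls_proj refl | simp)+
  qed auto
qed

lemma calls_parity: "calls p parity_proc [x] (x mod 2)"
  unfolding parity_proc_def
  by (rule calls_cond calls_comp1 calls_double calls_half calls_const calls_proj refl | simp)+
    presburger


section \<open>Inverting the pairing function\<close>

text \<open>
  Deciding whether \<open>x = J (m, n)\<close> for some \<open>n\<close> requires a search that always ends. Since \<open>n \<le> J (m, n)\<close>,
  one may stop at \<open>n = x\<close>; testing the number found decides the question, and an outer search over \<open>m\<close>
  then inverts \<open>J\<close>.
\<close>
definition partner_proc :: "proc \<Rightarrow> proc" where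
  "partner_proc C = mu 2 (comp_proc 3 if_eq [comp_proc 3 C [proj 1, proj 0], proj 2, const 0,
     comp_proc 3 if_eq [proj 0, proj 2, const 0, const 1]])"

definition fst_proc :: "proc \<Rightarrow> proc" where
  "fst_proc C = mu 1 (comp_proc 2 if_eq
     [comp_proc 2 C [proj 0, comp_proc 2 (partner_proc C) [proj 0, proj 1]],
      proj 1, const 0, const 1])"

definition snd_proc :: "proc \<Rightarrow> proc" where
  "snd_proc C = mu 1 (comp_proc 2 if_eq
     [comp_proc 2 C [comp_proc 2 (fst_proc C) [proj 1], proj 0], proj 1, const 0, const 1])"

context
  fixes J :: "nat \<times> nat \<Rightarrow> nat" and C :: proc and p :: state
  assumes inj: "inj J" and bound: "\<And>m n. max m n \<le> J (m, n)"
    and C: "\<And>x y. calls p C [x, y] (J (x, y))"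
begin

lemma calls_partner:
  "calls p (partner_proc C) [m, x] (LEAST n. J (m, n) = x \<or> n = x)"
proof -
  let ?g = "\<lambda>n. if J (m, n) = x then 0 else if n = x then 0 else 1 :: nat"
  let ?y = "LEAST n. J (m, n) = x \<or> n = x"
  have least: "J (m, ?y) = x \<or> ?y = x" by (rule LeastI[of _ x]) simp
  show ?thesis
    unfolding partner_proc_def
  proof (rule calls_mu[where g = ?g])
    fix j
    show "calls p (comp_proc 3 if_eq [comp_proc 3 C [proj 1, proj 0], proj 2, const 0,
        comp_proc 3 if_eq [proj 0, proj 2, const 0, const 1]]) [j, m, x] (?g j)"
      by (rule calls_cond calls_comp2 calls_const calls_proj C refl | simp)+
  next
    show "?g j \<noteq> 0" if "j < ?y" for j using not_less_Least[OF that] by simp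
    show "?g ?y = 0" using least by auto
  qed simp
qed

lemma partner_iff: "J (m, LEAST n. J (m, n) = x \<or> n = x) = x \<longleftrightarrow> (\<exists>n. J (m, n) = x)"
proof
  assume "\<exists>n. J (m, n) = x"
  then obtain n where n: "J (m, n) = x" by blast
  let ?y = "LEAST n. J (m, n) = x \<or> n = x"
  have "?y \<le> n" by (rule Least_le) (simp add: n)
  moreover have "n \<le> x" using bound[of m n] n by simp
  moreover have "J (m, ?y) = x \<or> ?y = x" by (rule LeastI[of _ n]) (simp add: n)
  ultimately show "J (m, ?y) = x" using n by auto
qed blast

lemma calls_fst: "calls p (fst_proc C) [J (a, b)] a"
proof -
  let ?x = "J (a, b)"
  let ?n = "\<lambda>m. LEAST n. J (m, n) = ?x \<or> n = ?x"
  let ?g = "\<lambda>m. if J (m, ?n m) = ?x then 0 else 1 :: nat"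
  show ?thesis
    unfolding fst_proc_def
  proof (rule calls_mu[where g = ?g])
    fix j
    show "calls p (comp_proc 2 if_eq [comp_proc 2 C [proj 0,
        comp_proc 2 (partner_proc C) [proj 0, proj 1]], proj 1, const 0, const 1]) [j, ?x] (?g j)"
      by (rule calls_cond calls_comp2 calls_const calls_proj C calls_partner refl | simp)+
  next
    show "?g j \<noteq> 0" if "j < a" for j
      using that inj by (auto simp: partner_iff dest: injD)
    show "?g a = 0" by (auto simp: partner_iff)
  qed simp
qed

lemma calls_snd: "calls p (snd_proc C) [J (a, b)] b"
proof -
  let ?x = "J (a, b)"
  let ?g = "\<lambda>n. if J (a, n) = ?x then 0 else 1 :: nat"
  show ?thesis
    unfolding snd_proc_def
  proof (rule calls_mu[where g = ?g])
    fix j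
    show "calls p (comp_proc 2 if_eq [comp_proc 2 C [comp_proc 2 (fst_proc C) [proj 1], proj 0],
        proj 1, const 0, const 1]) [j, ?x] (?g j)"
      by (rule calls_cond calls_comp2 calls_comp1 calls_const calls_proj C calls_fst refl | simp)+
  next
    show "?g j \<noteq> 0" if "j < b" for j using that inj by (auto dest: injD)
  qed simp_all
qed

lemma pairing_procs_of_pairing: "pairing_procs p J C (fst_proc C) (snd_proc C)"
  unfolding pairing_procs_def using C calls_fst calls_snd by blast

end

lemma outputs_oracle_free:
  assumes "\<forall>n. Oracle n \<notin> set P" "outputs P p xs y"
  shows "outputs P p' xs y"
proof -
  have "exec_instr p i cf = exec_instr p' i cf" if "i \<in> set P" for i cf
    using assms(1) that by (cases i; cases cf) auto
  then have "step P p = step P p'"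
    by (auto simp: step_def halted_def fun_eq_iff)
  then show ?thesis using assms(2) by (simp add: outputs_def)
qed

text \<open>
  Here the pairing procedures of the simulator are dummies, as a tower of height \<open>0\<close> has no stack.
\<close>
lemma computable2_calls:
  assumes "computable2 J"
  shows "\<exists>C. \<forall>p x y. calls p C [x, y] (J (x, y))"
proof -
  obtain P where P: "\<forall>n. Oracle n \<notin> set P" "\<And>x y. outputs P (\<lambda>_. 0) [x, y] (J (x, y))"
    using assms unfolding computable2_def by blast
  \<comment> \<open>The program of the pairing function contains no oracle instruction, so it may be run with \<open>p\<close>.\<close>
  let ?S = "tower_proc (const 0) (const 0) (const 0) P [] 2"
  have "calls p (comp_proc 2 ?S [const 0, proj 0, proj 1]) [x, y] (J (x, y))" for p x y
  proof (rule calls_comp)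
    show "list_all2 (\<lambda>G. calls p G [x, y]) [const 0, proj 0, proj 1] [0, x, y]"
      by (auto intro: calls_const calls_proj)
    show "calls p ?S [0, x, y] (J (x, y))"
      by (rule calls_tower[where q = "\<lambda>_. p"]) (simp_all add: outputs_oracle_free[OF P])
  qed simp_all
  then show ?thesis by blast
qed

section \<open>Realizations on the Moschovakis extension\<close>

text \<open>
  The effect of a component function on a single entry \<open>x\<close> of a name: \<open>0\<close> occurs only in the name of \<open>ob\<close>, other
  even entries only in names of elements of \<open>X\<close>, and an odd entry is \<open>2 J(\<dots>) + 1\<close> with \<open>D\<close> inverting \<open>J\<close>.
\<close>
definition selector_proc :: "nat \<Rightarrow> proc \<Rightarrow> proc" where
  "selector_proc c D = comp_proc 1 if_eq [proj 0, const 0, const 0,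
     comp_proc 1 if_eq [parity_proc, const 0, const c, comp_proc 1 D [half_proc]]]"

lemma calls_selector:
  assumes "calls p D [x div 2] d"
  shows "calls p (selector_proc c D) [x] (if x = 0 then 0 else if x mod 2 = 0 then c else d)"
  unfolding selector_proc_def
  by (rule calls_cond calls_comp1 calls_const calls_proj calls_parity calls_half assms refl
      | simp)+

locale moschovakis_representation =
  fixes X :: "'a set" and \<rho> :: "(nat \<Rightarrow> nat) \<rightharpoonup> 'a"
    and ob :: 'a and pair :: "'a \<times> 'a \<Rightarrow> 'a" and J :: "nat \<times> nat \<Rightarrow> nat"
  assumes representation: "representation \<rho> X"
    and moschovakis: "moschovakis_data X ob pair"
    and bij_J: "bij J" and computable_J: "computable2 J"
    and J_ge: "\<And>m n. J (m, n) \<ge> max m n"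
begin

abbreviation names :: "(nat \<Rightarrow> nat) \<Rightarrow> 'a \<Rightarrow> bool" where
  "names \<equiv> star_graph ob pair J \<rho>"

abbreviation ext :: "'a set" where
  "ext \<equiv> mosch_ext X ob pair"

abbreviation \<B> :: "('a \<rightharpoonup> 'a) set" where
  "\<B> \<equiv> B1 X ob pair J \<rho>"

lemma inj_J: "inj J"
  using bij_J by (rule bij_is_inj)

lemma named_iff: "z \<in> ext \<longleftrightarrow> (\<exists>p. names p z)"
  using representation_rep_star[OF inj_J representation, of ob pair]
  by (auto simp: representation_def ran_def rep_star_eq_Some_iff[OF inj_J])

lemma pair_not_atom: "pair (x, y) \<notin> X" "pair (x, y) \<noteq> ob"
  using moschovakis by (auto simp: moschovakis_data_def)

text \<open>
  Any single entry of a name tells whether the named object is an atom.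
\<close>
lemma names_atom_iff:
  assumes "names q z"
  shows "z \<in> X \<union> {ob} \<longleftrightarrow> q k mod 2 = 0"
  using assms
proof cases
  case (base r)
  then have "z \<in> X" using representation by (auto simp: representation_def ran_def)
  then show ?thesis using base by simp
next
  case obj
  then show ?thesis by simp
next
  case (pair r x s y)
  then show ?thesis using pair_not_atom by simp
qed

definition pair_proc :: proc where
  "pair_proc = (SOME C. \<forall>p x y. calls p C [x, y] (J (x, y)))"

lemma calls_pair: "calls p pair_proc [x, y] (J (x, y))"
  using someI_ex[OF computable2_calls[OF computable_J]] unfolding pair_proc_def by blast

lemmas calls_fst_pair = calls_fst[OF inj_J J_ge calls_pair]
lemmas calls_snd_pair = calls_snd[OF inj_J J_ge calls_pair]

definition iter_proc :: "instr list \<Rightarrow> instr list \<Rightarrow> proc" where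
  "iter_proc Q P = tower_proc pair_proc (fst_proc pair_proc) (snd_proc pair_proc) Q P 1"

lemma calls_iter:
  assumes "q 0 = p" "\<And>i k. i < e \<Longrightarrow> outputs P (q i) [k] (q (Suc i) k)" "outputs Q (q e) [k] y"
  shows "calls p (iter_proc Q P) [e, k] y"
  unfolding iter_proc_def
proof (rule calls_tower[where q = q])
  show "e = 0 \<or> pairing_procs p J pair_proc (fst_proc pair_proc) (snd_proc pair_proc)"
    using pairing_procs_of_pairing[OF inj_J J_ge calls_pair] by blast
qed (simp_all add: assms)

text \<open>
  It suffices to compute some name of the value from every name of the argument. That the values lie
  in the extension is automatic, because exactly its elements have names.
\<close>
lemma B_memI:
  assumes dom: "dom \<phi> \<subseteq> ext"
    and C: "\<And>p z z'. names p z \<Longrightarrow> \<phi> z = Some z' \<Longrightarrow>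
      \<exists>q. names q z' \<and> (\<forall>k. calls p C [k] (q k))"
  shows "\<phi> \<in> \<B>"
proof -
  let ?D = "{p. \<exists>z z'. names p z \<and> \<phi> z = Some z'}"
  let ?R = "\<lambda>p q. (\<forall>z z'. names p z \<longrightarrow> \<phi> z = Some z' \<longrightarrow> names q z') \<and> (\<forall>k. calls p C [k] (q k))"
  have "\<exists>q. ?R p q" if "p \<in> ?D" for p
  proof -
    obtain z z' where z: "names p z" "\<phi> z = Some z'" using \<open>p \<in> ?D\<close> by auto
    obtain q where q: "names q z'" "\<forall>k. calls p C [k] (q k)" using C[OF z] by blast
    have "names q w'" if "names p w" "\<phi> w = Some w'" for w w'
      using star_graph_functional[OF inj_J z(1) that(1)] z(2) that(2) q(1) by simp
    then show ?thesis using q(2) by blast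
  qed
  then have "\<forall>p\<in>?D. \<exists>q. ?R p q" by blast
  from bchoice[OF this] obtain G where G: "\<forall>p\<in>?D. ?R p (G p)" ..
  let ?\<gamma> = "(\<lambda>p. Some (G p)) |` ?D"
  have "type2_computable ?\<gamma>"
    unfolding type2_computable_def
  proof (intro exI[of _ "C 0 0"] ballI allI)
    fix p k assume "p \<in> dom ?\<gamma>"
    then have "p \<in> ?D" by (simp only: dom_restrict Int_iff)
    then have "calls p C [k] (G p k)" using G by blast
    then show "outputs (C 0 0) p [k] (the (?\<gamma> p) k)"
      using \<open>p \<in> ?D\<close> by (auto dest: outputs_of_calls)
  qed
  moreover have "realization (rep_star ob pair J \<rho>) (rep_star ob pair J \<rho>) \<phi> ?\<gamma>"
    unfolding realization_def
  proof (intro allI impI)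
    fix p assume "p \<in> dom (rep_star ob pair J \<rho>) \<and> the (rep_star ob pair J \<rho> p) \<in> dom \<phi>"
    then obtain z z' where z: "rep_star ob pair J \<rho> p = Some z" "\<phi> z = Some z'" by auto
    then have p: "names p z" by (simp add: rep_star_eq_Some_iff[OF inj_J])
    then have D: "p \<in> ?D" using z(2) by blast
    then have "names (G p) z'" using G p z(2) by blast
    then have "rep_star ob pair J \<rho> (G p) = Some z'" by (simp add: rep_star_eq_Some_iff[OF inj_J])
    then show "p \<in> dom ?\<gamma> \<and> the (?\<gamma> p) \<in> dom (rep_star ob pair J \<rho>) \<and>
        the (\<phi> (the (rep_star ob pair J \<rho> p))) = the (rep_star ob pair J \<rho> (the (?\<gamma> p)))"
      using z D by auto
  qed
  moreover have "\<phi> \<in> pfuns ext"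
  proof -
    have "z' \<in> ext" if "\<phi> z = Some z'" for z z'
    proof -
      have "z \<in> ext" using dom that by blast
      then obtain p where "names p z" using named_iff by blast
      then show ?thesis using C that named_iff by blast
    qed
    then show ?thesis using dom by (auto simp: pfuns_def ran_def)
  qed
  ultimately show ?thesis by (auto simp: B1_def rep_computable_def)
qed

text \<open>
  The program \<open>P\<close> computes a total operator \<open>G\<close> which is correct on the names of elements of the domain.
  Totality of \<open>G\<close> allows it to be iterated without regard to domains.
\<close>
definition realizes :: "instr list \<Rightarrow> (state \<Rightarrow> state) \<Rightarrow> ('a \<rightharpoonup> 'a) \<Rightarrow> bool" where
  "realizes P G \<phi> \<longleftrightarrow> (\<forall>p z z'. names p z \<longrightarrow> \<phi> z = Some z' \<longrightarrow>
     names (G p) z' \<and> (\<forall>k. outputs P p [k] (G p k)))"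

lemma realizesD:
  assumes "realizes P G \<phi>" "names p z" "\<phi> z = Some z'"
  shows "names (G p) z'" "outputs P p [k] (G p k)"
  using assms unfolding realizes_def by blast+

lemma B_memE:
  assumes "\<phi> \<in> \<B>"
  obtains P G where "realizes P G \<phi>"
proof -
  obtain \<gamma> where \<gamma>: "type2_computable \<gamma>"
    "realization (rep_star ob pair J \<rho>) (rep_star ob pair J \<rho>) \<phi> \<gamma>"
    using assms by (auto simp: B1_def rep_computable_def)
  obtain P where P: "\<And>p k. p \<in> dom \<gamma> \<Longrightarrow> outputs P p [k] (the (\<gamma> p) k)"
    using \<gamma>(1) unfolding type2_computable_def by blast
  have "p \<in> dom \<gamma> \<and> names (the (\<gamma> p)) z'" if "names p z" "\<phi> z = Some z'" for p z z'
  proof -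
    have z: "rep_star ob pair J \<rho> p = Some z"
      using that(1) by (simp add: rep_star_eq_Some_iff[OF inj_J])
    then have "p \<in> dom (rep_star ob pair J \<rho>) \<and> the (rep_star ob pair J \<rho> p) \<in> dom \<phi>"
      using that(2) by auto
    then have g: "p \<in> dom \<gamma>" "the (\<gamma> p) \<in> dom (rep_star ob pair J \<rho>)"
      "the (\<phi> (the (rep_star ob pair J \<rho> p))) = the (rep_star ob pair J \<rho> (the (\<gamma> p)))"
      using \<gamma>(2) unfolding realization_def by blast+
    then have "rep_star ob pair J \<rho> (the (\<gamma> p)) = Some z'" using z that(2) by auto
    then show ?thesis using g(1) by (simp add: rep_star_eq_Some_iff[OF inj_J])
  qed
  then have "realizes P (\<lambda>p. the (\<gamma> p)) \<phi>"
    unfolding realizes_def using P by blast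
  then show thesis by (rule that)
qed

lemma names_const_pair: "names (\<lambda>k. 2 * J (0, 0) + 1) (pair (ob, ob))"
  by (rule star_graph.pair[OF star_graph.obj star_graph.obj])

text \<open>
  The common argument for \<open>L\<^sub>1\<close> and \<open>R\<^sub>1\<close>, with \<open>g\<close> the component function on pairs and \<open>sel\<close> its counterpart on
  numbers.
\<close>
lemma selector_in_B:
  assumes D: "\<And>p x y. calls p D [J (x, y)] (sel (x, y))"
    and names: "\<And>q r x y. names q x \<Longrightarrow> names r y \<Longrightarrow>
      names (\<lambda>k. sel (q k, r k)) (g (pair (x, y)))"
  shows "(\<lambda>z. Some (if z = ob then ob else if z \<in> X then pair (ob, ob) else g z)) |` ext \<in> \<B>"
    (is "?\<phi> \<in> \<B>")
proof (rule B_memI)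
  \<comment> \<open>The entries of the name of \<open>pair (ob, ob)\<close>, the value at elements of \<open>X\<close>.\<close>
  let ?c = "2 * J (0, 0) + 1"
  let ?C = "comp_proc 1 (selector_proc ?c D) [query]"
  let ?q = "\<lambda>p k. if p k = 0 then 0 else if p k mod 2 = 0 then ?c else sel (inv J (p k div 2))"
  fix p z z' assume p: "names p z" and z: "?\<phi> z = Some z'"
  have "calls p D [x] (sel (inv J x))" for x
  proof -
    have "J (inv J x) = x" using bij_J by (simp add: bij_is_surj surj_f_inv_f)
    then show ?thesis using D[of p "fst (inv J x)" "snd (inv J x)"] by simp
  qed
  then have "\<forall>k. calls p ?C [k] (?q p k)"
    by (intro allI calls_comp1[OF calls_query calls_selector]) simp_all
  moreover have "names (?q p) z'"
    using p
  proof cases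
    case (base r)
    then have "z \<in> X" using representation by (auto simp: representation_def ran_def)
    moreover have "z \<noteq> ob" using \<open>z \<in> X\<close> moschovakis by (auto simp: moschovakis_data_def)
    ultimately have "z' = pair (ob, ob)" using z by (auto simp: restrict_map_def split: if_splits)
    moreover have "?q p = (\<lambda>k. ?c)" using base by (auto simp: fun_eq_iff)
    ultimately show ?thesis using names_const_pair by simp
  next
    case obj
    then have "z' = ob" "?q p = (\<lambda>k. 0)"
      using z by (auto simp: restrict_map_def split: if_splits)
    then show ?thesis by (simp add: star_graph.obj)
  next
    case (pair q x r y)
    then have "z' = g (pair (x, y))"
      using z pair_not_atom by (auto simp: restrict_map_def split: if_splits)
    moreover have "?q p = (\<lambda>k. sel (q k, r k))"
      using pair by (auto simp: fun_eq_iff inv_f_f[OF inj_J])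
    ultimately show ?thesis using names pair by simp
  qed
  ultimately show "\<exists>q. names q z' \<and> (\<forall>k. calls p ?C [k] (q k))" by blast
qed (auto simp: restrict_map_def split: if_splits)


lemma L1_in_B: "L1 X ob pair \<in> \<B>"
  unfolding L1_def
proof (rule selector_in_B[where sel = fst and D = "fst_proc pair_proc"])
  fix q r x y assume "names q x"
  moreover have "(THE a. \<exists>b. pair (x, y) = pair (a, b)) = x"
    using moschovakis by (auto simp: moschovakis_data_def inj_eq)
  ultimately show "names (\<lambda>k. fst (q k, r k)) (THE a. \<exists>b. pair (x, y) = pair (a, b))" by simp
qed (simp add: calls_fst_pair)

lemma R1_in_B: "R1 X ob pair \<in> \<B>"
  unfolding R1_def
proof (rule selector_in_B[where sel = snd and D = "snd_proc pair_proc"])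
  fix q r x y assume "names r y"
  moreover have "(THE b. \<exists>a. pair (x, y) = pair (a, b)) = y"
    using moschovakis by (auto simp: moschovakis_data_def inj_eq)
  ultimately show "names (\<lambda>k. snd (q k, r k)) (THE b. \<exists>a. pair (x, y) = pair (a, b))" by simp
qed (simp add: calls_snd_pair)

lemma constant_in_B:
  assumes "names (\<lambda>k. c) z"
  shows "(\<lambda>_. Some z) |` ext \<in> \<B>"
proof (rule B_memI)
  fix p w z' assume "((\<lambda>_. Some z) |` ext) w = Some z'"
  then have "z' = z" by (auto simp: restrict_map_def split: if_splits)
  then show "\<exists>q. names q z' \<and> (\<forall>k. calls p (const c) [k] (q k))"
    using assms calls_const by (intro exI[of _ "\<lambda>k. c"]) auto
qed (auto simp: restrict_map_def split: if_splits)

text \<open>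
  A tower of height one: the oracle of the program for \<open>\<phi>\<close> is the output of the program for \<open>\<psi>\<close>.
\<close>
lemma comp_in_B:
  assumes "\<phi> \<in> \<B>" "\<psi> \<in> \<B>"
  shows "\<phi> \<circ>\<^sub>m \<psi> \<in> \<B>"
proof -
  obtain P G where P_real: "realizes P G \<phi>"
    using assms(1) by (rule B_memE)
  note P = realizesD[OF P_real]
  obtain Q H where Q_real: "realizes Q H \<psi>"
    using assms(2) by (rule B_memE)
  note Q = realizesD[OF Q_real]
  show ?thesis
  proof (rule B_memI)
    show "dom (\<phi> \<circ>\<^sub>m \<psi>) \<subseteq> ext"
      using assms(2) by (auto simp: B1_def pfuns_def map_comp_def split: option.splits)
  next
    fix p z z' assume p: "names p z" and "(\<phi> \<circ>\<^sub>m \<psi>) z = Some z'"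
    then obtain w where w: "\<psi> z = Some w" "\<phi> w = Some z'"
      by (auto simp: map_comp_def split: option.splits)
    have H: "names (H p) w" by (rule Q(1)[OF p w(1)])
    have "calls p (comp_proc 1 (iter_proc P Q) [const 1, proj 0]) [k] (G (H p) k)" for k
    proof (rule calls_comp2)
      show "calls p (iter_proc P Q) [1, k] (G (H p) k)"
        by (rule calls_iter[where q = "\<lambda>i. if i = 0 then p else H p"])
          (simp_all add: Q(2)[OF p w(1)] P(2)[OF H w(2)])
    qed (simp_all add: calls_const calls_proj)
    then show "\<exists>q. names q z' \<and>
        (\<forall>k. calls p (comp_proc 1 (iter_proc P Q) [const 1, proj 0]) [k] (q k))"
      using P(1)[OF H w(2)] by blast
  qed
qed

lemma Pi1_in_B:
  assumes "\<phi> \<in> \<B>" "\<psi> \<in> \<B>"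
  shows "Pi1 pair \<phi> \<psi> \<in> \<B>"
proof -
  obtain P G where P_real: "realizes P G \<phi>"
    using assms(1) by (rule B_memE)
  note P = realizesD[OF P_real]
  obtain Q H where Q_real: "realizes Q H \<psi>"
    using assms(2) by (rule B_memE)
  note Q = realizesD[OF Q_real]
  let ?run = "\<lambda>R. comp_proc 1 (iter_proc R []) [const 0, proj 0]"
  let ?C = "comp_proc 1 add [comp_proc 1 double_proc [comp_proc 1 pair_proc [?run P, ?run Q]],
    const 1]"
  have run: "calls p (?run R) [k] y" if "outputs R p [k] y" for R p k y
  proof (rule calls_comp2)
    show "calls p (iter_proc R []) [0, k] y"
      by (rule calls_iter[where q = "\<lambda>_. p"]) (simp_all add: that)
  qed (simp_all add: calls_const calls_proj)
  show ?thesis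
  proof (rule B_memI)
    show "dom (Pi1 pair \<phi> \<psi>) \<subseteq> ext"
      using assms(1) by (auto simp: B1_def pfuns_def Pi1_def restrict_map_def split: if_splits)
  next
    fix p z z' assume p: "names p z" and "Pi1 pair \<phi> \<psi> z = Some z'"
    then obtain x y where x: "\<phi> z = Some x" and y: "\<psi> z = Some y" and z': "z' = pair (x, y)"
      by (auto simp: Pi1_def restrict_map_def split: if_splits)
    have "calls p ?C [k] (2 * J (G p k, H p k) + 1)" for k
      by (rule calls_comp2[OF calls_comp1[OF calls_comp2[OF
                run[OF P(2)[OF p x]] run[OF Q(2)[OF p y]] calls_pair] calls_double]
            calls_const calls_add]) simp_all
    moreover have "names (\<lambda>k. 2 * J (G p k, H p k) + 1) z'"
      unfolding z' by (rule star_graph.pair[OF P(1)[OF p x] Q(1)[OF p y]])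
    ultimately show "\<exists>q. names q z' \<and> (\<forall>k. calls p ?C [k] (q k))"
      by (intro exI[of _ "\<lambda>k. 2 * J (G p k, H p k) + 1"]) blast
  qed
qed

text \<open>
  The length of the sequence of iterates depends only on the named object, not on its name: it is the
  first index at which \<open>\<chi>\<close> takes an atom as its value, and the parity of entry \<open>0\<close> of a name of that value
  detects this. A second tower with the program \<open>[Oracle 0]\<close> on top, which merely queries its oracle,
  then reads the iterate found.
\<close>
lemma iteration_in_B:
  assumes "\<sigma> \<in> \<B>" "\<chi> \<in> \<B>"
  shows "iteration X ob \<sigma> \<chi> \<in> \<B>"
proof -
  obtain P G where P_real: "realizes P G \<sigma>"
    using assms(1) by (rule B_memE)
  note P = realizesD[OF P_real]
  obtain Q H where Q_real: "realizes Q H \<chi>"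
    using assms(2) by (rule B_memE)
  note Q = realizesD[OF Q_real]
  let ?test = "comp_proc 2 parity_proc [comp_proc 2 (iter_proc Q P) [proj 0, const 0]]"
  let ?C = "comp_proc 1 (iter_proc [Oracle 0] P) [mu 1 ?test, proj 0]"
  show ?thesis
  proof (rule B_memI)
    have "z \<in> dom \<chi>" if "iteration X ob \<sigma> \<chi> z = Some v" for z v
      using that by (auto simp: iteration_eq_Some_iff iter_graph_def dest: hd_in_set)
    then show "dom (iteration X ob \<sigma> \<chi>) \<subseteq> ext"
      using assms(2) by (auto simp: B1_def pfuns_def)
  next
    fix p z v assume p: "names p z" and "iteration X ob \<sigma> \<chi> z = Some v"
    then obtain us where us: "us \<noteq> []" "hd us = z" "last us = v" "set us \<subseteq> dom \<chi>"
      and steps: "\<And>i. Suc i < length us \<Longrightarrow>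
        the (\<chi> (us ! i)) \<notin> X \<union> {ob} \<and> us ! i \<in> dom \<sigma> \<and> us ! Suc i = the (\<sigma> (us ! i))"
      and stop: "the (\<chi> v) \<in> X \<union> {ob}"
      unfolding iteration_eq_Some_iff iter_graph_def by blast
    define m where "m = length us - 1"
    have len: "length us = Suc m" using us(1) by (simp add: m_def)
    have last: "us ! m = v" using us(1,3) by (simp add: m_def last_conv_nth)
    define q where "q i = (G ^^ i) p" for i
    have \<sigma>: "\<sigma> (us ! i) = Some (us ! Suc i)" if "i < m" for i
      using steps[of i] that len by auto
    have names: "names (q i) (us ! i)" if "i \<le> m" for i
      using that
    proof (induction i)
      case 0
      then show ?case using p us by (simp add: q_def hd_conv_nth)
    next
      case (Suc i)
      then show ?case using P(1)[of "q i"] \<sigma>[of i] by (simp add: q_def)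
    qed
    have q0: "q 0 = p" by (simp add: q_def)
    have qSuc: "outputs P (q i) [k] (q (Suc i) k)" if "i < m" for i k
      using P(2)[OF names \<sigma>] that by (simp add: q_def)
    have \<chi>: "\<chi> (us ! i) = Some (the (\<chi> (us ! i)))" if "i \<le> m" for i
    proof -
      have "us ! i \<in> set us" using that len by simp
      then show ?thesis using us(4) by auto
    qed
    let ?g = "\<lambda>i. H (q i) 0 mod 2"
    have atom: "the (\<chi> (us ! i)) \<in> X \<union> {ob} \<longleftrightarrow> ?g i = 0" if "i \<le> m" for i
      by (rule names_atom_iff) (rule Q(1)[OF names[OF that] \<chi>[OF that]])
    \<comment> \<open>The argument \<open>k\<close> is only carried along; the test always inspects entry \<open>0\<close>.\<close>
    have "calls p (mu 1 ?test) [k] m" for k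
    proof (rule calls_mu[where g = ?g])
      fix j assume j: "j \<le> m"
      show "calls p ?test [j, k] (?g j)"
      proof (rule calls_comp1[OF calls_comp2 calls_parity])
        show "calls p (iter_proc Q P) [j, 0] (H (q j) 0)"
          by (rule calls_iter[where q = q])
            (use j in \<open>simp_all add: q0 qSuc Q(2)[OF names[OF j] \<chi>[OF j]]\<close>)
      qed (simp_all add: calls_const calls_proj)
    next
      show "?g j \<noteq> 0" if "j < m" for j using steps[of j] atom[of j] that len by auto
      show "?g m = 0" using stop atom[of m] last by simp
    qed simp
    moreover have "calls p (iter_proc [Oracle 0] P) [m, k] (q m k)" for k
    proof (rule calls_iter[where q = q])
      show "outputs [Oracle 0] (q m) [k] (q m k)"
        unfolding outputs_def
        by (rule exI[of _ 1]) (simp add: step_def halted_def init_config_def)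
    qed (simp_all add: q0 qSuc)
    ultimately have "calls p ?C [k] (q m k)" for k
      by (intro calls_comp2[OF _ calls_proj]) simp_all
    moreover have "names (q m) v" using names[of m] last by simp
    ultimately show "\<exists>q. names q v \<and> (\<forall>k. calls p ?C [k] (q k))" by blast
  qed
qed

lemma S1_computable_in_B: "\<theta> \<in> S1_computable X ob pair \<B> \<Longrightarrow> \<theta> \<in> \<B>"
proof (induction rule: S1_computable.induct)
  case T
  show ?case unfolding T1_def by (rule constant_in_B[OF names_const_pair])
next
  case F
  show ?case unfolding F1_def by (rule constant_in_B[OF star_graph.obj])
qed (auto intro: L1_in_B R1_in_B comp_in_B Pi1_in_B iteration_in_B)

end

theorem theorem3p12:
  fixes X :: "'a set" and \<rho> :: "(nat \<Rightarrow> nat) \<rightharpoonup> 'a"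
    and ob :: 'a and pair :: "'a \<times> 'a \<Rightarrow> 'a" and J :: "nat \<times> nat \<Rightarrow> nat"
  assumes "representation \<rho> X"
    and "moschovakis_data X ob pair"
    and "bij J" and "computable2 J" and "\<And>m n. J (m, n) \<ge> max m n"
  shows "S1_computable X ob pair (B1 X ob pair J \<rho>) \<subseteq> B1 X ob pair J \<rho>"
proof -
  interpret moschovakis_representation X \<rho> ob pair J
    using assms by unfold_locales
  show ?thesis using S1_computable_in_B by blast
qed

end
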